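(* Every pre-Hilbert $*$-category that has all $\ell^2$-products (i.e. $\ell^2$-products of all set-indexed families of objects) is orthogonally complete.
   Context: A $*$-category is a category equipped with a choice of morphism $f^*\colon Y\to X$ for each morphism $f\colon X\to Y$ such that $1^*=1$, $(gf)^*=f^*g^*$ and $(f^* )^*=f$. A morphism $f$ is an isometry if $f^*f=1$, and a coisometry if $ff^*=1$. In a $*$-category with a zero object, a binary product $(r_1\colon X\to X_1,\ r_2\colon X\to X_2)$ is orthonormal if $r_1,r_2$ are coisometries and $r_1r_2^*=0$. A pre-Hilbert $*$-category is a $*$-category with a zero object, in which every pair of objects has an orthonormal product (written $X_1\oplus X_2$), every morphism has a kernel that is an isometry, and, for each object $X$, the diagonal $X\to X\oplus X$ (with both components $1$) is a kernel of some morphism. It is known that every pre-Hilbert $*$-category $\mathbf{C}$ is canonically enriched in rational vector spaces, with $(f+g)^*=f^*+g^*$, orthonormal products being biproducts. For each object $A$, the Hermitian elements ($a^*=a$) of $\mathbf{C}(A,A)$ are partially ordered by: $f\le g$ iff $g-f=h^*h$ for some morphism $h\colon A\to X$. For objects $A,X$, the hom-set $\mathbf{C}(A,X)$ is an inner product module over $\mathbf{C}(A,A)$ with inner product $\langle f, g\rangle=f^*g$. For a set $J$, $\mathcal{F}J$ is the set of finite subsets of $J$, directed by inclusion. For a family $(a_j)_{j\in J}$ of positive elements ($a_j\ge 0$) of $\mathbf{C}(A,A)$, $\sum_{j\in J}a_j$ denotes $\sup_{F\in\mathcal{F}J}\sum_{j\in F}a_j$ (least upper bound, if it exists, with respect to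 the partial order on Hermitian elements of $\mathbf{C}(A,A)$ in which $f\le g$ iff $g-f=h^*h$ for some morphism $h$ with domain $A$). An $\ell^2$-span on a family $(X_j)_{j\in J}$ of objects is a span $(g_j\colon Y\to X_j)_{j\in J}$ such that the net $(\sum_{j\in F}g_j^*g_j)_{F\in\mathcal{F}J}$ in $\mathbf{C}(Y,Y)$ is bounded above. An $\ell^2$-product of $(X_j)_{j\in J}$ is an $\ell^2$-span $(r_j\colon X\to X_j)_{j\in J}$ such that for all $\ell^2$-spans $(g_j\colon Y\to X_j)_{j\in J}$ there is a unique morphism $g\colon Y\to X$ with $r_jg=g_j$ for all $j\in J$, and this $g$ satisfies $g^*g=\sum_{j\in J}g_j^*g_j$ (in particular this supremum exists). An $\ell^2$-family in $\mathbf{C}(A,X)$ is a family $(x_j)_{j\in J}$ of morphisms $x_j\colon A\to X$ that is orthogonal ($x_j^*x_k=0$ for $j\ne k$) and such that the net $(\sum_{j\in F}x_j^*x_j)_{F\in\mathcal{F}J}$ in $\mathbf{C}(A,A)$ is bounded above. An order sum of an orthogonal family $(x_j)_{j\in J}$ in $\mathbf{C}(A,X)$ is a morphism $s\colon A\to X$ such that $s^*x_j=x_j^*x_j$ for each $j\in J$ and $s^*s=\sum_{j\in J}x_j^*x_j$ (in particular this supremum exists). The pre-Hilbert $*$-category $\mathbf{C}$ is orthogonally complete if, for all objects $A$ and $X$, every $\ell^2$-family in $\mathbf{C}(A,X)$ has an order sum. *)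

theory Defs
  imports "HOL-Algebra.Ring"
begin

section \<open>\<open>*\<close>-categories\<close>

record ('o, 'm) star_cat =
  objs :: "'o set"
  arrs :: "'m set"
  src :: "'m \<Rightarrow> 'o"
  tgt :: "'m \<Rightarrow> 'o"
  ident :: "'o \<Rightarrow> 'm"
  cmp :: "'m \<Rightarrow> 'm \<Rightarrow> 'm" (infixl "\<cdot>\<index>" 75)
  star :: "'m \<Rightarrow> 'm" ("_\<^sup>\<star>\<index>" [1000] 999)

text \<open>\<open>g \<cdot> f\<close> is the composite ``first \<open>f\<close>, then \<open>g\<close>''. All operations are
  meaningful only on \<open>arrs\<close>, resp. \<open>objs\<close>, resp. composable pairs.\<close>

definition Hom :: "('o, 'm) star_cat \<Rightarrow> 'o \<Rightarrow> 'o \<Rightarrow> 'm set" where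
  "Hom C A B = {f \<in> arrs C. src C f = A \<and> tgt C f = B}"

locale star_category =
  fixes C :: "('o, 'm) star_cat" (structure)
  assumes src_obj: "f \<in> arrs C \<Longrightarrow> src C f \<in> objs C"
    and tgt_obj: "f \<in> arrs C \<Longrightarrow> tgt C f \<in> objs C"
    and ident_in_Hom: "A \<in> objs C \<Longrightarrow> ident C A \<in> Hom C A A"
    and cmp_in_Hom: "\<lbrakk>f \<in> Hom C X Y; g \<in> Hom C Y Z\<rbrakk> \<Longrightarrow> g \<cdot> f \<in> Hom C X Z"
    and cmp_ident: "f \<in> Hom C X Y \<Longrightarrow> f \<cdot> ident C X = f"
    and ident_cmp: "f \<in> Hom C X Y \<Longrightarrow> ident C Y \<cdot> f = f"
    and cmp_assoc: "\<lbrakk>f \<in> Hom C W X; g \<in> Hom C X Y; h \<in> Hom C Y Z\<rbrakk> \<Longrightarrow> (h \<cdot> g) \<cdot> f = h \<cdot> (g \<cdot> f)"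
    and star_in_Hom: "f \<in> Hom C X Y \<Longrightarrow> f\<^sup>\<star> \<in> Hom C Y X"
    and star_ident: "A \<in> objs C \<Longrightarrow> (ident C A)\<^sup>\<star> = ident C A"
    and star_cmp: "\<lbrakk>f \<in> Hom C X Y; g \<in> Hom C Y Z\<rbrakk> \<Longrightarrow> (g \<cdot> f)\<^sup>\<star> = f\<^sup>\<star> \<cdot> g\<^sup>\<star>"
    and star_star: "f \<in> arrs C \<Longrightarrow> (f\<^sup>\<star>)\<^sup>\<star> = f"

definition isometry :: "('o, 'm) star_cat \<Rightarrow> 'm \<Rightarrow> bool" where
  "isometry C f \<longleftrightarrow> f \<in> arrs C \<and> f\<^sup>\<star>\<^bsub>C\<^esub> \<cdot>\<^bsub>C\<^esub> f = ident C (src C f)"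

definition coisometry :: "('o, 'm) star_cat \<Rightarrow> 'm \<Rightarrow> bool" where
  "coisometry C f \<longleftrightarrow> f \<in> arrs C \<and> f \<cdot>\<^bsub>C\<^esub> f\<^sup>\<star>\<^bsub>C\<^esub> = ident C (tgt C f)"

definition zero_object :: "('o, 'm) star_cat \<Rightarrow> 'o \<Rightarrow> bool" where
  "zero_object C Z \<longleftrightarrow> Z \<in> objs C \<and>
     (\<forall>A\<in>objs C. (\<exists>!f. f \<in> Hom C A Z) \<and> (\<exists>!f. f \<in> Hom C Z A))"

definition zero_arr :: "('o, 'm) star_cat \<Rightarrow> 'o \<Rightarrow> 'o \<Rightarrow> 'm" where
  "zero_arr C A B = (THE f. \<exists>Z h k. zero_object C Z \<and> h \<in> Hom C A Z \<and> k \<in> Hom C Z B \<and> f = k \<cdot>\<^bsub>C\<^esub> h)"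

definition binary_product :: "('o, 'm) star_cat \<Rightarrow> 'o \<Rightarrow> 'o \<Rightarrow> 'o \<Rightarrow> 'm \<Rightarrow> 'm \<Rightarrow> bool" where
  "binary_product C X1 X2 P r1 r2 \<longleftrightarrow>
     P \<in> objs C \<and> X1 \<in> objs C \<and> X2 \<in> objs C \<and> r1 \<in> Hom C P X1 \<and> r2 \<in> Hom C P X2 \<and>
     (\<forall>Y\<in>objs C. \<forall>f\<in>Hom C Y X1. \<forall>g\<in>Hom C Y X2.
        \<exists>!h. h \<in> Hom C Y P \<and> r1 \<cdot>\<^bsub>C\<^esub> h = f \<and> r2 \<cdot>\<^bsub>C\<^esub> h = g)"

definition orthonormal_product :: "('o, 'm) star_cat \<Rightarrow> 'o \<Rightarrow> 'o \<Rightarrow> 'o \<Rightarrow> 'm \<Rightarrow> 'm \<Rightarrow> bool" where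
  "orthonormal_product C X1 X2 P r1 r2 \<longleftrightarrow>
     binary_product C X1 X2 P r1 r2 \<and> coisometry C r1 \<and> coisometry C r2 \<and>
     r1 \<cdot>\<^bsub>C\<^esub> r2\<^sup>\<star>\<^bsub>C\<^esub> = zero_arr C X2 X1"

definition is_kernel :: "('o, 'm) star_cat \<Rightarrow> 'm \<Rightarrow> 'm \<Rightarrow> bool" where
  "is_kernel C k f \<longleftrightarrow> f \<in> arrs C \<and> k \<in> arrs C \<and> tgt C k = src C f \<and>
     f \<cdot>\<^bsub>C\<^esub> k = zero_arr C (src C k) (tgt C f) \<and>
     (\<forall>Y\<in>objs C. \<forall>g\<in>Hom C Y (src C f). f \<cdot>\<^bsub>C\<^esub> g = zero_arr C Y (tgt C f) \<longrightarrow>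
        (\<exists>!h. h \<in> Hom C Y (src C k) \<and> k \<cdot>\<^bsub>C\<^esub> h = g))"

section \<open>Pre-Hilbert \<open>*\<close>-categories\<close>

text \<open>Orthonormal products of two given objects are unique up to a unique compatible unitary
  isomorphism, so the condition on diagonals does not depend on the product that is used.\<close>

locale pre_hilbert_star_category = star_category +
  assumes ex_zero_object: "\<exists>Z. zero_object C Z"
    and ex_orthonormal_product:
      "\<lbrakk>X1 \<in> objs C; X2 \<in> objs C\<rbrakk> \<Longrightarrow> \<exists>P r1 r2. orthonormal_product C X1 X2 P r1 r2"
    and ex_isometric_kernel: "f \<in> arrs C \<Longrightarrow> \<exists>k. is_kernel C k f \<and> isometry C k"
    and diagonal_is_kernel:
      "\<lbrakk>orthonormal_product C X X P r1 r2; d \<in> Hom C X P; r1 \<cdot> d = ident C X; r2 \<cdot> d = ident C X\<rbrakk>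
        \<Longrightarrow> \<exists>f. is_kernel C d f"

text \<open>The canonical addition of \<open>f, g: A \<rightarrow> B\<close> is the composite
  \<open>A \<rightarrow> B \<oplus> B \<rightarrow> B\<close> of the pairing \<open>p\<close> of \<open>f\<close> and \<open>g\<close> with the codiagonal \<open>n\<close>;
  the coproduct injections of the biproduct \<open>B \<oplus> B\<close> are the adjoints of its projections.\<close>

definition arr_add :: "('o, 'm) star_cat \<Rightarrow> 'm \<Rightarrow> 'm \<Rightarrow> 'm" where
  "arr_add C f g = (THE h. \<exists>P r1 r2 p n.
     orthonormal_product C (tgt C f) (tgt C f) P r1 r2 \<and>
     p \<in> Hom C (src C f) P \<and> r1 \<cdot>\<^bsub>C\<^esub> p = f \<and> r2 \<cdot>\<^bsub>C\<^esub> p = g \<and>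
     n \<in> Hom C P (tgt C f) \<and>
     n \<cdot>\<^bsub>C\<^esub> r1\<^sup>\<star>\<^bsub>C\<^esub> = ident C (tgt C f) \<and> n \<cdot>\<^bsub>C\<^esub> r2\<^sup>\<star>\<^bsub>C\<^esub> = ident C (tgt C f) \<and>
     h = n \<cdot>\<^bsub>C\<^esub> p)"

definition End :: "('o, 'm) star_cat \<Rightarrow> 'o \<Rightarrow> 'm ring" where
  "End C A = \<lparr>carrier = Hom C A A, mult = cmp C, one = ident C A,
     zero = zero_arr C A A, add = arr_add C\<rparr>"

definition hermitian :: "('o, 'm) star_cat \<Rightarrow> 'o \<Rightarrow> 'm \<Rightarrow> bool" where
  "hermitian C A a \<longleftrightarrow> a \<in> Hom C A A \<and> a\<^sup>\<star>\<^bsub>C\<^esub> = a"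

definition herm_le :: "('o, 'm) star_cat \<Rightarrow> 'o \<Rightarrow> 'm \<Rightarrow> 'm \<Rightarrow> bool" where
  "herm_le C A a b \<longleftrightarrow> hermitian C A a \<and> hermitian C A b \<and>
     (\<exists>X h. h \<in> Hom C A X \<and> b \<ominus>\<^bsub>End C A\<^esub> a = h\<^sup>\<star>\<^bsub>C\<^esub> \<cdot>\<^bsub>C\<^esub> h)"

definition herm_upper_bound :: "('o, 'm) star_cat \<Rightarrow> 'o \<Rightarrow> 'm set \<Rightarrow> 'm \<Rightarrow> bool" where
  "herm_upper_bound C A S u \<longleftrightarrow> hermitian C A u \<and> (\<forall>a\<in>S. herm_le C A a u)"

definition herm_sup :: "('o, 'm) star_cat \<Rightarrow> 'o \<Rightarrow> 'm set \<Rightarrow> 'm \<Rightarrow> bool" where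
  "herm_sup C A S s \<longleftrightarrow> herm_upper_bound C A S s \<and>
     (\<forall>u. herm_upper_bound C A S u \<longrightarrow> herm_le C A s u)"

definition partial_sums :: "('o, 'm) star_cat \<Rightarrow> 'o \<Rightarrow> 'i set \<Rightarrow> ('i \<Rightarrow> 'm) \<Rightarrow> 'm set" where
  "partial_sums C A J a = (\<lambda>F. finsum (End C A) a F) ` Fpow J"

section \<open>\<open>\<ell>\<^sup>2\<close>-products and orthogonal completeness\<close>

definition l2_span ::
  "('o, 'm) star_cat \<Rightarrow> 'i set \<Rightarrow> ('i \<Rightarrow> 'o) \<Rightarrow> 'o \<Rightarrow> ('i \<Rightarrow> 'm) \<Rightarrow> bool" where
  "l2_span C J X Y g \<longleftrightarrow> Y \<in> objs C \<and> (\<forall>j\<in>J. g j \<in> Hom C Y (X j)) \<and>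
     (\<exists>u. herm_upper_bound C Y (partial_sums C Y J (\<lambda>j. (g j)\<^sup>\<star>\<^bsub>C\<^esub> \<cdot>\<^bsub>C\<^esub> g j)) u)"

definition l2_product ::
  "('o, 'm) star_cat \<Rightarrow> 'i set \<Rightarrow> ('i \<Rightarrow> 'o) \<Rightarrow> 'o \<Rightarrow> ('i \<Rightarrow> 'm) \<Rightarrow> bool" where
  "l2_product C J X P r \<longleftrightarrow> l2_span C J X P r \<and>
     (\<forall>Y g. l2_span C J X Y g \<longrightarrow>
        (\<exists>!h. h \<in> Hom C Y P \<and> (\<forall>j\<in>J. r j \<cdot>\<^bsub>C\<^esub> h = g j)) \<and>
        (\<forall>h. h \<in> Hom C Y P \<and> (\<forall>j\<in>J. r j \<cdot>\<^bsub>C\<^esub> h = g j) \<longrightarrow>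
           herm_sup C Y (partial_sums C Y J (\<lambda>j. (g j)\<^sup>\<star>\<^bsub>C\<^esub> \<cdot>\<^bsub>C\<^esub> g j)) (h\<^sup>\<star>\<^bsub>C\<^esub> \<cdot>\<^bsub>C\<^esub> h)))"

definition orthogonal_family ::
  "('o, 'm) star_cat \<Rightarrow> 'o \<Rightarrow> 'o \<Rightarrow> 'i set \<Rightarrow> ('i \<Rightarrow> 'm) \<Rightarrow> bool" where
  "orthogonal_family C A X J x \<longleftrightarrow> (\<forall>j\<in>J. x j \<in> Hom C A X) \<and>
     (\<forall>j\<in>J. \<forall>k\<in>J. j \<noteq> k \<longrightarrow> (x j)\<^sup>\<star>\<^bsub>C\<^esub> \<cdot>\<^bsub>C\<^esub> x k = zero_arr C A A)"

definition l2_family ::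
  "('o, 'm) star_cat \<Rightarrow> 'o \<Rightarrow> 'o \<Rightarrow> 'i set \<Rightarrow> ('i \<Rightarrow> 'm) \<Rightarrow> bool" where
  "l2_family C A X J x \<longleftrightarrow> orthogonal_family C A X J x \<and>
     (\<exists>u. herm_upper_bound C A (partial_sums C A J (\<lambda>j. (x j)\<^sup>\<star>\<^bsub>C\<^esub> \<cdot>\<^bsub>C\<^esub> x j)) u)"

definition order_sum ::
  "('o, 'm) star_cat \<Rightarrow> 'o \<Rightarrow> 'o \<Rightarrow> 'i set \<Rightarrow> ('i \<Rightarrow> 'm) \<Rightarrow> 'm \<Rightarrow> bool" where
  "order_sum C A X J x s \<longleftrightarrow> s \<in> Hom C A X \<and>
     (\<forall>j\<in>J. s\<^sup>\<star>\<^bsub>C\<^esub> \<cdot>\<^bsub>C\<^esub> x j = (x j)\<^sup>\<star>\<^bsub>C\<^esub> \<cdot>\<^bsub>C\<^esub> x j) \<and>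
     herm_sup C A (partial_sums C A J (\<lambda>j. (x j)\<^sup>\<star>\<^bsub>C\<^esub> \<cdot>\<^bsub>C\<^esub> x j)) (s\<^sup>\<star>\<^bsub>C\<^esub> \<cdot>\<^bsub>C\<^esub> s)"

text \<open>HOL cannot quantify over all sets of all types inside a formula. The two properties below
  are therefore indexed by the type \<open>'i\<close> from which the index sets \<open>J\<close> are taken; the
  unrestricted notions are their conjunction over all types \<open>'i\<close>.\<close>

definition has_l2_products :: "'i itself \<Rightarrow> ('o, 'm) star_cat \<Rightarrow> bool" where
  "has_l2_products _ C \<longleftrightarrow>
     (\<forall>(J :: 'i set) X. (\<forall>j\<in>J. X j \<in> objs C) \<longrightarrow> (\<exists>P r. l2_product C J X P r))"

definition orthogonally_complete :: "'i itself \<Rightarrow> ('o, 'm) star_cat \<Rightarrow> bool" where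
  "orthogonally_complete _ C \<longleftrightarrow>
     (\<forall>A\<in>objs C. \<forall>X\<in>objs C. \<forall>(J :: 'i set) x. l2_family C A X J x \<longrightarrow> (\<exists>s. order_sum C A X J x s))"

end

theory Submission
  imports Defs
begin

text \<open>Let \<open>x j : A \<rightarrow> X\<close> be an \<open>\<ell>\<^sup>2\<close>-family. Factor each \<open>x j\<close> as \<open>i j \<cdot> e j\<close>, where
  \<open>i j : Y j \<rightarrow> X\<close> is an isometry onto the double orthogonal complement of \<open>x j\<close>
  (\<open>image_factorisation\<close>); orthogonality of the family makes the \<open>i j\<close> pairwise orthogonal. Let
  \<open>(r j : P \<rightarrow> Y j)\<close> be an \<open>\<ell>\<^sup>2\<close>-product of the \<open>Y j\<close>. The adjoints of the \<open>i j\<close> form an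
  \<open>\<ell>\<^sup>2\<close>-span, since finite sums of the projections \<open>i j \<cdot> (i j)\<^sup>\<star>\<close> are projections and hence
  bounded by \<open>1\<close> (\<open>orthogonal_isometries_bounded\<close>), so they induce \<open>g : X \<rightarrow> P\<close> with
  \<open>g\<^sup>\<star> \<cdot> g \<le> 1\<close>. The \<open>e j\<close> form an \<open>\<ell>\<^sup>2\<close>-span because \<open>(e j)\<^sup>\<star> \<cdot> e j = (x j)\<^sup>\<star> \<cdot> x j\<close>, and
  induce \<open>h : A \<rightarrow> P\<close>. The order sum is \<open>s = g\<^sup>\<star> \<cdot> h\<close>.

  The key point is that \<open>g \<cdot> i k = (r k)\<^sup>\<star>\<close>. Both \<open>r k\<close> and \<open>g \<cdot> i k\<close> are contractions, the former
  because the span \<open>r\<close> factors through itself by the identity, and \<open>r k \<cdot> (g \<cdot> i k) = 1\<close>; a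
  contractive section of a contraction is its adjoint (\<open>contractive_section_eq_star\<close>). Joint
  monicity of the \<open>r k\<close> then gives \<open>g \<cdot> g\<^sup>\<star> = 1\<close>, so that \<open>s\<^sup>\<star> \<cdot> s = h\<^sup>\<star> \<cdot> h\<close> is the required
  supremum, while \<open>s\<^sup>\<star> \<cdot> x j = h\<^sup>\<star> \<cdot> g \<cdot> i j \<cdot> e j = (r j \<cdot> h)\<^sup>\<star> \<cdot> e j = (x j)\<^sup>\<star> \<cdot> x j\<close>.

  The order refers to differences of endomorphisms, so the argument needs endomorphisms to form a
  ring (\<open>ring_End\<close>). Addition is defined through orthonormal products, and additive inverses come
  from the diagonals being kernels (\<open>ident_negative\<close>).\<close>

section \<open>Composition, adjoints and zero morphisms\<close>

context star_category
begin

lemma arr_cmp: "\<lbrakk>f \<in> arrs C; g \<in> arrs C; tgt C f = src C g\<rbrakk> \<Longrightarrow> g \<cdot> f \<in> arrs C"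
  and src_cmp: "\<lbrakk>f \<in> arrs C; g \<in> arrs C; tgt C f = src C g\<rbrakk> \<Longrightarrow> src C (g \<cdot> f) = src C f"
  and tgt_cmp: "\<lbrakk>f \<in> arrs C; g \<in> arrs C; tgt C f = src C g\<rbrakk> \<Longrightarrow> tgt C (g \<cdot> f) = tgt C g"
  using cmp_in_Hom[of f "src C f" "tgt C f" g "tgt C g"] by (auto simp: Hom_def)

lemma arr_star: "f \<in> arrs C \<Longrightarrow> f\<^sup>\<star> \<in> arrs C"
  and src_star: "f \<in> arrs C \<Longrightarrow> src C (f\<^sup>\<star>) = tgt C f"
  and tgt_star: "f \<in> arrs C \<Longrightarrow> tgt C (f\<^sup>\<star>) = src C f"
  using star_in_Hom[of f "src C f" "tgt C f"] by (auto simp: Hom_def)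

lemma arr_ident: "A \<in> objs C \<Longrightarrow> ident C A \<in> arrs C"
  and src_ident: "A \<in> objs C \<Longrightarrow> src C (ident C A) = A"
  and tgt_ident: "A \<in> objs C \<Longrightarrow> tgt C (ident C A) = A"
  using ident_in_Hom[of A] by (auto simp: Hom_def)

lemma cmp_assoc_arrs:
  "\<lbrakk>f \<in> arrs C; g \<in> arrs C; h \<in> arrs C; tgt C f = src C g; tgt C g = src C h\<rbrakk>
    \<Longrightarrow> (h \<cdot> g) \<cdot> f = h \<cdot> (g \<cdot> f)"
  by (rule cmp_assoc[of f "src C f" "src C g" g "src C h" h "tgt C h"]) (auto simp: Hom_def)

lemma cmp_ident_arrs: "\<lbrakk>f \<in> arrs C; src C f = A\<rbrakk> \<Longrightarrow> f \<cdot> ident C A = f"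
  and ident_cmp_arrs: "\<lbrakk>f \<in> arrs C; tgt C f = A\<rbrakk> \<Longrightarrow> ident C A \<cdot> f = f"
  using cmp_ident[of f] ident_cmp[of f] by (auto simp: Hom_def)

lemma star_cmp_arrs: "\<lbrakk>f \<in> arrs C; g \<in> arrs C; tgt C f = src C g\<rbrakk> \<Longrightarrow> (g \<cdot> f)\<^sup>\<star> = f\<^sup>\<star> \<cdot> g\<^sup>\<star>"
  by (rule star_cmp[of f "src C f" "src C g" g "tgt C g"]) (auto simp: Hom_def)

lemmas cat_simps =
  src_obj tgt_obj arr_cmp src_cmp tgt_cmp arr_star src_star tgt_star arr_ident src_ident tgt_ident
  cmp_assoc_arrs cmp_ident_arrs ident_cmp_arrs star_cmp_arrs star_star star_ident

lemma HomD:
  assumes "f \<in> Hom C A B"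
  shows "f \<in> arrs C" "src C f = A" "tgt C f = B" "A \<in> objs C" "B \<in> objs C"
  using assms src_obj tgt_obj by (auto simp: Hom_def)

text \<open>An equation between composites can be prolonged on the right.\<close>

lemma cmp_reassoc:
  assumes "g \<cdot> f = h" "f \<in> arrs C" "g \<in> arrs C" "tgt C f = src C g" "a \<in> arrs C" "tgt C a = src C f"
  shows "g \<cdot> (f \<cdot> a) = h \<cdot> a"
  using assms cmp_assoc_arrs[of a f g] by simp

end

context pre_hilbert_star_category
begin

lemma zero_arr_eq:
  assumes Z: "zero_object C Z" and h: "h \<in> Hom C A Z" and k: "k \<in> Hom C Z B"
  shows "zero_arr C A B = k \<cdot> h"
  unfolding zero_arr_def
proof (rule the_equality)
  show "\<exists>Z h' k'. zero_object C Z \<and> h' \<in> Hom C A Z \<and> k' \<in> Hom C Z B \<and> k \<cdot> h = k' \<cdot> h'"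
    using assms by blast
next
  fix f assume "\<exists>Z h k. zero_object C Z \<and> h \<in> Hom C A Z \<and> k \<in> Hom C Z B \<and> f = k \<cdot> h"
  then obtain Z' h' k' where Z': "zero_object C Z'" and h': "h' \<in> Hom C A Z'"
    and k': "k' \<in> Hom C Z' B" and f: "f = k' \<cdot> h'" by blast
  have ob: "Z \<in> objs C" "Z' \<in> objs C" "A \<in> objs C" "B \<in> objs C"
    using h h' k HomD by metis+
  obtain t where t: "t \<in> Hom C Z Z'" using Z' ob by (auto simp: zero_object_def)
  have "t \<cdot> h \<in> Hom C A Z'" using h t cmp_in_Hom by blast
  then have 1: "h' = t \<cdot> h" using Z' h' ob by (auto simp: zero_object_def)
  have "k' \<cdot> t \<in> Hom C Z B" using t k' cmp_in_Hom by blast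
  then have 2: "k = k' \<cdot> t" using Z k ob by (auto simp: zero_object_def)
  show "f = k \<cdot> h" unfolding f 1 2 using cmp_assoc[OF h t k'] by simp
qed

lemma zero_arr_obtain:
  assumes "A \<in> objs C" "B \<in> objs C"
  obtains Z h k where "zero_object C Z" "h \<in> Hom C A Z" "k \<in> Hom C Z B" "zero_arr C A B = k \<cdot> h"
proof -
  obtain Z where Z: "zero_object C Z" using ex_zero_object by blast
  then have "\<exists>!h. h \<in> Hom C A Z" "\<exists>!k. k \<in> Hom C Z B"
    using assms by (simp_all add: zero_object_def)
  then obtain h k where hk: "h \<in> Hom C A Z" "k \<in> Hom C Z B" by auto
  show thesis by (rule that[OF Z hk zero_arr_eq[OF Z hk]])
qed

lemma zero_in_Hom: "\<lbrakk>A \<in> objs C; B \<in> objs C\<rbrakk> \<Longrightarrow> zero_arr C A B \<in> Hom C A B"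
  by (erule (1) zero_arr_obtain) (simp add: cmp_in_Hom)

lemma arr_zero: "\<lbrakk>A \<in> objs C; B \<in> objs C\<rbrakk> \<Longrightarrow> zero_arr C A B \<in> arrs C"
  and src_zero: "\<lbrakk>A \<in> objs C; B \<in> objs C\<rbrakk> \<Longrightarrow> src C (zero_arr C A B) = A"
  and tgt_zero: "\<lbrakk>A \<in> objs C; B \<in> objs C\<rbrakk> \<Longrightarrow> tgt C (zero_arr C A B) = B"
  using zero_in_Hom by (auto simp: Hom_def)

lemma cmp_zero:
  assumes "A \<in> objs C" "f \<in> arrs C" "src C f = B"
  shows "f \<cdot> zero_arr C A B = zero_arr C A (tgt C f)"
proof -
  have f: "f \<in> Hom C B (tgt C f)" using assms by (simp add: Hom_def)
  obtain Z h k where Z: "zero_object C Z" "h \<in> Hom C A Z" "k \<in> Hom C Z B" "zero_arr C A B = k \<cdot> h"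
    using zero_arr_obtain assms src_obj by metis
  have "zero_arr C A (tgt C f) = (f \<cdot> k) \<cdot> h"
    by (rule zero_arr_eq[OF Z(1,2)]) (rule cmp_in_Hom[OF Z(3) f])
  then show ?thesis using Z cmp_assoc[OF Z(2,3) f] by simp
qed

lemma star_zero:
  assumes "A \<in> objs C" "B \<in> objs C"
  shows "(zero_arr C A B)\<^sup>\<star> = zero_arr C B A"
proof -
  obtain Z h k where Z: "zero_object C Z" "h \<in> Hom C A Z" "k \<in> Hom C Z B" "zero_arr C A B = k \<cdot> h"
    using zero_arr_obtain assms by metis
  have "zero_arr C B A = h\<^sup>\<star> \<cdot> k\<^sup>\<star>"
    by (rule zero_arr_eq[OF Z(1)]) (use Z star_in_Hom in blast)+
  then show ?thesis using Z star_cmp by metis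
qed

lemma zero_cmp:
  assumes f: "f \<in> arrs C" "tgt C f = A" and B: "B \<in> objs C"
  shows "zero_arr C A B \<cdot> f = zero_arr C (src C f) B"
proof -
  have A: "A \<in> objs C" using f tgt_obj by blast
  have "f\<^sup>\<star> \<cdot> zero_arr C B A = zero_arr C B (src C f)"
    using cmp_zero[of B "f\<^sup>\<star>" A] f B by (simp add: cat_simps)
  then have "(f\<^sup>\<star> \<cdot> zero_arr C B A)\<^sup>\<star> = (zero_arr C B (src C f))\<^sup>\<star>" by simp
  then show ?thesis
    using f A B by (simp add: cat_simps star_zero arr_zero tgt_zero)
qed

lemmas zero_simps = arr_zero src_zero tgt_zero cmp_zero zero_cmp star_zero

text \<open>An isometric kernel \<open>k\<close>, with the existence part of its universal property.\<close>

lemma isometric_kernel: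
  assumes f: "f \<in> Hom C A B"
  obtains K k where "k \<in> Hom C K A" "k\<^sup>\<star> \<cdot> k = ident C K" "f \<cdot> k = zero_arr C K B"
    "\<And>Y g. \<lbrakk>g \<in> Hom C Y A; f \<cdot> g = zero_arr C Y B\<rbrakk> \<Longrightarrow> \<exists>h\<in>Hom C Y K. k \<cdot> h = g"
proof -
  note F = HomD[OF f]
  obtain k where k: "is_kernel C k f" "isometry C k"
    using ex_isometric_kernel[OF F(1)] by blast
  note k' = k(1)[unfolded is_kernel_def F(2,3)]
  show thesis
  proof (rule that[of k "src C k"])
    show "k \<in> Hom C (src C k) A" "k\<^sup>\<star> \<cdot> k = ident C (src C k)" "f \<cdot> k = zero_arr C (src C k) B"
      using k' k(2) by (simp_all add: Hom_def isometry_def)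
    fix Y g assume g: "g \<in> Hom C Y A" "f \<cdot> g = zero_arr C Y B"
    then have "\<exists>!h. h \<in> Hom C Y (src C k) \<and> k \<cdot> h = g" using k' HomD(4)[OF g(1)] by simp
    then show "\<exists>h\<in>Hom C Y (src C k). k \<cdot> h = g" by auto
  qed
qed

text \<open>Anisotropy: a morphism \<open>f\<close> with \<open>f\<^sup>\<star> \<cdot> f = 0\<close> factors through an isometric kernel \<open>k\<close>
  of \<open>f\<^sup>\<star>\<close>, and \<open>f = k \<cdot> h\<close> together with \<open>f\<^sup>\<star> \<cdot> k = 0\<close> gives \<open>h\<^sup>\<star> = 0\<close>.\<close>

lemma anisotropic:
  assumes f: "f \<in> Hom C A B" and 0: "f\<^sup>\<star> \<cdot> f = zero_arr C A A"
  shows "f = zero_arr C A B"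
proof -
  note F = HomD[OF f]
  obtain Y k where k: "k \<in> Hom C Y B" "k\<^sup>\<star> \<cdot> k = ident C Y" "f\<^sup>\<star> \<cdot> k = zero_arr C Y A"
    and ku: "\<And>W g. \<lbrakk>g \<in> Hom C W B; f\<^sup>\<star> \<cdot> g = zero_arr C W A\<rbrakk> \<Longrightarrow> \<exists>h\<in>Hom C W Y. k \<cdot> h = g"
    by (rule isometric_kernel[OF star_in_Hom[OF f]]) (rule that; blast)
  obtain h where h: "h \<in> Hom C A Y" "k \<cdot> h = f" using ku[OF f 0] by blast
  note H = HomD[OF h(1)] HomD[OF k(1)]
  have "f\<^sup>\<star> \<cdot> k = h\<^sup>\<star>"
    by (simp add: h(2)[symmetric] H k(2) cat_simps)
  then have "h\<^sup>\<star> = zero_arr C Y A" using k(3) by simp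
  then have "h = zero_arr C A Y" using star_star[OF H(1)] star_zero[OF H(5,4)] by simp
  then show ?thesis using h(2) H by (simp add: zero_simps)
qed

section \<open>Orthonormal products and the addition of morphisms\<close>

lemma orthonormal_productD:
  assumes "orthonormal_product C X1 X2 P r1 r2"
  shows "P \<in> objs C" "X1 \<in> objs C" "X2 \<in> objs C"
    "r1 \<in> arrs C" "src C r1 = P" "tgt C r1 = X1" "r2 \<in> arrs C" "src C r2 = P" "tgt C r2 = X2"
    "r1 \<cdot> r1\<^sup>\<star> = ident C X1" "r2 \<cdot> r2\<^sup>\<star> = ident C X2"
    "r1 \<cdot> r2\<^sup>\<star> = zero_arr C X2 X1" "r2 \<cdot> r1\<^sup>\<star> = zero_arr C X1 X2"
proof -
  show *: "P \<in> objs C" "X1 \<in> objs C" "X2 \<in> objs C"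
    "r1 \<in> arrs C" "src C r1 = P" "tgt C r1 = X1" "r2 \<in> arrs C" "src C r2 = P" "tgt C r2 = X2"
    "r1 \<cdot> r1\<^sup>\<star> = ident C X1" "r2 \<cdot> r2\<^sup>\<star> = ident C X2" "r1 \<cdot> r2\<^sup>\<star> = zero_arr C X2 X1"
    using assms by (simp_all add: orthonormal_product_def binary_product_def coisometry_def Hom_def)
  show "r2 \<cdot> r1\<^sup>\<star> = zero_arr C X1 X2"
    using star_cmp_arrs[of "r2\<^sup>\<star>" r1] * by (simp add: cat_simps zero_simps)
qed

lemma product_universal:
  assumes "orthonormal_product C X1 X2 P r1 r2" "f \<in> Hom C Y X1" "g \<in> Hom C Y X2"
  shows "\<exists>!h. h \<in> Hom C Y P \<and> r1 \<cdot> h = f \<and> r2 \<cdot> h = g"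
  using assms(1)[unfolded orthonormal_product_def binary_product_def] assms(2,3) HomD(4)[OF assms(2)]
  by simp

lemma pairing:
  assumes "orthonormal_product C X1 X2 P r1 r2" "f \<in> Hom C Y X1" "g \<in> Hom C Y X2"
  obtains h where "h \<in> Hom C Y P" "r1 \<cdot> h = f" "r2 \<cdot> h = g"
  using product_universal[OF assms] by auto

lemma product_eqI:
  assumes P: "orthonormal_product C X1 X2 P r1 r2" and "a \<in> Hom C Y P" and b: "b \<in> Hom C Y P"
    and "r1 \<cdot> a = r1 \<cdot> b" "r2 \<cdot> a = r2 \<cdot> b"
  shows "a = b"
proof -
  have r: "r1 \<in> Hom C P X1" "r2 \<in> Hom C P X2"
    using orthonormal_productD[OF P] by (auto simp: Hom_def)
  show ?thesis
    using product_universal[OF P cmp_in_Hom[OF b r(1)] cmp_in_Hom[OF b r(2)]] assms by auto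
qed

text \<open>A morphism acting as \<open>f \<oplus> g\<close> with respect to the projections also acts as \<open>f \<oplus> g\<close> with
  respect to the injections, so its adjoint is \<open>f\<^sup>\<star> \<oplus> g\<^sup>\<star>\<close>.\<close>

lemma product_map_star:
  assumes P: "orthonormal_product C X1 X2 P r1 r2" and Q: "orthonormal_product C Y1 Y2 Q s1 s2"
    and f: "f \<in> Hom C X1 Y1" and g: "g \<in> Hom C X2 Y2" and p: "p \<in> Hom C P Q"
    and p1: "s1 \<cdot> p = f \<cdot> r1" and p2: "s2 \<cdot> p = g \<cdot> r2"
  shows "r1 \<cdot> p\<^sup>\<star> = f\<^sup>\<star> \<cdot> s1" and "r2 \<cdot> p\<^sup>\<star> = g\<^sup>\<star> \<cdot> s2"
proof -
  note D = orthonormal_productD[OF P] orthonormal_productD[OF Q] HomD[OF f] HomD[OF g] HomD[OF p]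
  note s = cat_simps zero_simps
  have "p \<cdot> r1\<^sup>\<star> = s1\<^sup>\<star> \<cdot> f"
    by (rule product_eqI[OF Q, of _ X1])
      (simp_all add: D s Hom_def cmp_reassoc[OF p1] cmp_reassoc[OF p2] cmp_reassoc[OF D(23)]
        cmp_reassoc[OF D(26)])
  then have "(p \<cdot> r1\<^sup>\<star>)\<^sup>\<star> = (s1\<^sup>\<star> \<cdot> f)\<^sup>\<star>" by simp
  then show "r1 \<cdot> p\<^sup>\<star> = f\<^sup>\<star> \<cdot> s1" by (simp add: D s)
  have "p \<cdot> r2\<^sup>\<star> = s2\<^sup>\<star> \<cdot> g"
    by (rule product_eqI[OF Q, of _ X2])
      (simp_all add: D s Hom_def cmp_reassoc[OF p1] cmp_reassoc[OF p2] cmp_reassoc[OF D(24)]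
        cmp_reassoc[OF D(25)])
  then have "(p \<cdot> r2\<^sup>\<star>)\<^sup>\<star> = (s2\<^sup>\<star> \<cdot> g)\<^sup>\<star>" by simp
  then show "r2 \<cdot> p\<^sup>\<star> = g\<^sup>\<star> \<cdot> s2" by (simp add: D s)
qed

text \<open>The codiagonal of \<open>B \<oplus> B\<close> is the adjoint of the diagonal \<open>d\<close>, and the sum does not depend on
  the choice of the product.\<close>

lemma arr_add_eq:
  assumes P: "orthonormal_product C B B P r1 r2" and p: "p \<in> Hom C A P"
    and d: "d \<in> Hom C B P" "r1 \<cdot> d = ident C B" "r2 \<cdot> d = ident C B"
  shows "arr_add C (r1 \<cdot> p) (r2 \<cdot> p) = d\<^sup>\<star> \<cdot> p"
proof -
  note s = cat_simps zero_simps
  note D = orthonormal_productD[OF P] HomD[OF p] HomD[OF d(1)]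
  have dstar: "d\<^sup>\<star> \<cdot> r1\<^sup>\<star> = ident C B" "d\<^sup>\<star> \<cdot> r2\<^sup>\<star> = ident C B"
    using star_cmp_arrs[of d r1] star_cmp_arrs[of d r2] by (simp_all add: D d s)
  have st: "src C (r1 \<cdot> p) = A" "tgt C (r1 \<cdot> p) = B" by (simp_all add: D s)
  show ?thesis
    unfolding arr_add_def
  proof (rule the_equality)
    show "\<exists>P r1' r2' p' n.
       orthonormal_product C (tgt C (r1 \<cdot> p)) (tgt C (r1 \<cdot> p)) P r1' r2' \<and>
       p' \<in> Hom C (src C (r1 \<cdot> p)) P \<and> r1' \<cdot> p' = r1 \<cdot> p \<and> r2' \<cdot> p' = r2 \<cdot> p \<and>
       n \<in> Hom C P (tgt C (r1 \<cdot> p)) \<and>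
       n \<cdot> r1'\<^sup>\<star> = ident C (tgt C (r1 \<cdot> p)) \<and> n \<cdot> r2'\<^sup>\<star> = ident C (tgt C (r1 \<cdot> p)) \<and>
       d\<^sup>\<star> \<cdot> p = n \<cdot> p'"
      unfolding st using P p star_in_Hom[OF d(1)] dstar by blast
  next
    fix h
    assume "\<exists>P r1' r2' p' n.
       orthonormal_product C (tgt C (r1 \<cdot> p)) (tgt C (r1 \<cdot> p)) P r1' r2' \<and>
       p' \<in> Hom C (src C (r1 \<cdot> p)) P \<and> r1' \<cdot> p' = r1 \<cdot> p \<and> r2' \<cdot> p' = r2 \<cdot> p \<and>
       n \<in> Hom C P (tgt C (r1 \<cdot> p)) \<and>
       n \<cdot> r1'\<^sup>\<star> = ident C (tgt C (r1 \<cdot> p)) \<and> n \<cdot> r2'\<^sup>\<star> = ident C (tgt C (r1 \<cdot> p)) \<and>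
       h = n \<cdot> p'"
    then obtain Q s1 s2 q n where Q: "orthonormal_product C B B Q s1 s2"
      and q: "q \<in> Hom C A Q" "s1 \<cdot> q = r1 \<cdot> p" "s2 \<cdot> q = r2 \<cdot> p"
      and n: "n \<in> Hom C Q B" "n \<cdot> s1\<^sup>\<star> = ident C B" "n \<cdot> s2\<^sup>\<star> = ident C B" and h: "h = n \<cdot> q"
      unfolding st by blast
    note E = orthonormal_productD[OF Q] HomD[OF q(1)] HomD[OF n(1)]
    obtain u where u: "u \<in> Hom C P Q" "s1 \<cdot> u = r1" "s2 \<cdot> u = r2"
      by (rule pairing[OF Q, of r1 P r2]) (auto simp: Hom_def D)
    note U = HomD[OF u(1)]
    have i: "ident C B \<in> Hom C B B" using ident_in_Hom D by blast
    have qu: "q = u \<cdot> p"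
      by (rule product_eqI[OF Q, of _ A])
        (simp_all add: D E U s Hom_def cmp_reassoc[OF u(2)] cmp_reassoc[OF u(3)] q)
    have us: "r1 \<cdot> u\<^sup>\<star> = s1" "r2 \<cdot> u\<^sup>\<star> = s2"
      using product_map_star[OF P Q i i u(1)] by (simp_all add: D E U u s)
    have s_n: "s1 \<cdot> n\<^sup>\<star> = ident C B" "s2 \<cdot> n\<^sup>\<star> = ident C B"
      using star_cmp_arrs[of "s1\<^sup>\<star>" n] star_cmp_arrs[of "s2\<^sup>\<star>" n] by (simp_all add: E n s)
    have "u\<^sup>\<star> \<cdot> n\<^sup>\<star> = d"
      by (rule product_eqI[OF P, of _ B])
        (simp_all add: D E U s Hom_def cmp_reassoc[OF us(1)] cmp_reassoc[OF us(2)] d s_n)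
    then have "(u\<^sup>\<star> \<cdot> n\<^sup>\<star>)\<^sup>\<star> = d\<^sup>\<star>" by simp
    then have nu: "n \<cdot> u = d\<^sup>\<star>" by (simp add: D E U s)
    show "h = d\<^sup>\<star> \<cdot> p"
      unfolding h qu by (simp add: D E U s cmp_reassoc[OF nu, symmetric])
  qed
qed

lemma diagonal_obtain:
  assumes "B \<in> objs C"
  obtains P r1 r2 d where "orthonormal_product C B B P r1 r2" "d \<in> Hom C B P"
    "r1 \<cdot> d = ident C B" "r2 \<cdot> d = ident C B"
proof -
  obtain P r1 r2 where P: "orthonormal_product C B B P r1 r2"
    using ex_orthonormal_product[OF assms assms] by blast
  show thesis
    by (rule pairing[OF P ident_in_Hom[OF assms] ident_in_Hom[OF assms]]) (rule that[OF P])
qed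

text \<open>The canonical addition, in infix notation; its arguments are meant to be parallel.\<close>

abbreviation plus (infixl "\<boxplus>" 65) where "f \<boxplus> g \<equiv> arr_add C f g"

lemma add_obtain:
  assumes f: "f \<in> Hom C A B" and g: "g \<in> Hom C A B"
  obtains P r1 r2 d p where "orthonormal_product C B B P r1 r2" "d \<in> Hom C B P"
    "r1 \<cdot> d = ident C B" "r2 \<cdot> d = ident C B" "p \<in> Hom C A P" "r1 \<cdot> p = f" "r2 \<cdot> p = g"
    "f \<boxplus> g = d\<^sup>\<star> \<cdot> p"
proof -
  obtain P r1 r2 d where P: "orthonormal_product C B B P r1 r2" and d: "d \<in> Hom C B P"
    "r1 \<cdot> d = ident C B" "r2 \<cdot> d = ident C B"
    by (rule diagonal_obtain[OF HomD(5)[OF f]])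
  obtain p where p: "p \<in> Hom C A P" "r1 \<cdot> p = f" "r2 \<cdot> p = g" by (rule pairing[OF P f g])
  show thesis
    by (rule that[OF P d p]) (use arr_add_eq[OF P p(1) d] p in simp)
qed

lemma add_in_Hom:
  assumes f: "f \<in> Hom C A B" and g: "g \<in> Hom C A B"
  shows "f \<boxplus> g \<in> Hom C A B"
proof (rule add_obtain[OF f g])
  fix P r1 r2 d p
  assume "d \<in> Hom C B P" "p \<in> Hom C A P" "f \<boxplus> g = d\<^sup>\<star> \<cdot> p"
  then show ?thesis using star_in_Hom cmp_in_Hom by simp
qed

lemma add_cmp:
  assumes f: "f \<in> Hom C A B" and g: "g \<in> Hom C A B" and h: "h \<in> Hom C W A"
  shows "(f \<boxplus> g) \<cdot> h = f \<cdot> h \<boxplus> g \<cdot> h"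
proof (rule add_obtain[OF f g])
  fix P r1 r2 d p
  assume P: "orthonormal_product C B B P r1 r2" and d: "d \<in> Hom C B P" "r1 \<cdot> d = ident C B"
    "r2 \<cdot> d = ident C B" and p: "p \<in> Hom C A P" "r1 \<cdot> p = f" "r2 \<cdot> p = g" "f \<boxplus> g = d\<^sup>\<star> \<cdot> p"
  note D = orthonormal_productD[OF P] HomD[OF d(1)] HomD[OF p(1)] HomD[OF h]
  have "r1 \<cdot> (p \<cdot> h) \<boxplus> r2 \<cdot> (p \<cdot> h) = d\<^sup>\<star> \<cdot> (p \<cdot> h)"
    by (rule arr_add_eq[OF P cmp_in_Hom[OF h p(1)] d])
  moreover have "r1 \<cdot> (p \<cdot> h) = f \<cdot> h" "r2 \<cdot> (p \<cdot> h) = g \<cdot> h"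
    by (rule cmp_reassoc; simp add: D p)+
  ultimately show ?thesis by (simp add: p(4) D cat_simps)
qed

text \<open>Both \<open>f + g\<close> and \<open>f\<^sup>\<star> + g\<^sup>\<star>\<close> are computed from \<open>f \<oplus> g\<close> and its adjoint, pre- and postcomposed
  with a diagonal and a codiagonal.\<close>

lemma star_add:
  assumes f: "f \<in> Hom C A B" and g: "g \<in> Hom C A B"
  shows "(f \<boxplus> g)\<^sup>\<star> = f\<^sup>\<star> \<boxplus> g\<^sup>\<star>"
proof -
  obtain P r1 r2 d where P: "orthonormal_product C A A P r1 r2" and d: "d \<in> Hom C A P"
    "r1 \<cdot> d = ident C A" "r2 \<cdot> d = ident C A"
    by (rule diagonal_obtain[OF HomD(4)[OF f]])
  obtain Q s1 s2 e where Q: "orthonormal_product C B B Q s1 s2" and e: "e \<in> Hom C B Q"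
    "s1 \<cdot> e = ident C B" "s2 \<cdot> e = ident C B"
    by (rule diagonal_obtain[OF HomD(5)[OF f]])
  note s = cat_simps zero_simps
  note D = orthonormal_productD[OF P] HomD[OF d(1)] orthonormal_productD[OF Q] HomD[OF e(1)]
    HomD[OF f] HomD[OF g]
  obtain u where u: "u \<in> Hom C P Q" "s1 \<cdot> u = f \<cdot> r1" "s2 \<cdot> u = g \<cdot> r2"
    by (rule pairing[OF Q, of "f \<cdot> r1" P "g \<cdot> r2"]) (simp_all add: D s Hom_def)
  note U = HomD[OF u(1)]
  note us = product_map_star[OF P Q f g u]
  have "s1 \<cdot> (u \<cdot> d) = f" "s2 \<cdot> (u \<cdot> d) = g"
    by (simp_all add: cmp_reassoc[OF u(2)] cmp_reassoc[OF u(3)] D U s d)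
  then have 1: "f \<boxplus> g = e\<^sup>\<star> \<cdot> (u \<cdot> d)"
    using arr_add_eq[OF Q cmp_in_Hom[OF d(1) u(1)] e] by simp
  have "r1 \<cdot> (u\<^sup>\<star> \<cdot> e) = f\<^sup>\<star>" "r2 \<cdot> (u\<^sup>\<star> \<cdot> e) = g\<^sup>\<star>"
    by (simp_all add: cmp_reassoc[OF us(1)] cmp_reassoc[OF us(2)] D U s e)
  then have 2: "f\<^sup>\<star> \<boxplus> g\<^sup>\<star> = d\<^sup>\<star> \<cdot> (u\<^sup>\<star> \<cdot> e)"
    using arr_add_eq[OF P cmp_in_Hom[OF e(1) star_in_Hom[OF u(1)]] d] by simp
  show ?thesis unfolding 1 2 by (simp add: D U s)
qed

lemma cmp_add:
  assumes f: "f \<in> Hom C A B" and g: "g \<in> Hom C A B" and h: "h \<in> Hom C B W"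
  shows "h \<cdot> (f \<boxplus> g) = h \<cdot> f \<boxplus> h \<cdot> g"
proof -
  note H = star_in_Hom
  have "(h \<cdot> (f \<boxplus> g))\<^sup>\<star> = (f\<^sup>\<star> \<boxplus> g\<^sup>\<star>) \<cdot> h\<^sup>\<star>"
    by (simp add: star_cmp[OF add_in_Hom[OF f g] h] star_add[OF f g])
  also have "\<dots> = f\<^sup>\<star> \<cdot> h\<^sup>\<star> \<boxplus> g\<^sup>\<star> \<cdot> h\<^sup>\<star>" by (rule add_cmp[OF H[OF f] H[OF g] H[OF h]])
  also have "\<dots> = (h \<cdot> f \<boxplus> h \<cdot> g)\<^sup>\<star>"
    by (simp add: star_add[OF cmp_in_Hom[OF f h] cmp_in_Hom[OF g h]] star_cmp[OF f h] star_cmp[OF g h])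
  finally have "((h \<cdot> (f \<boxplus> g))\<^sup>\<star>)\<^sup>\<star> = ((h \<cdot> f \<boxplus> h \<cdot> g)\<^sup>\<star>)\<^sup>\<star>" by simp
  then show ?thesis
    using HomD(1)[OF cmp_in_Hom[OF add_in_Hom[OF f g] h]]
      HomD(1)[OF add_in_Hom[OF cmp_in_Hom[OF f h] cmp_in_Hom[OF g h]]]
    by (simp add: star_star)
qed

lemma add_zero:
  assumes f: "f \<in> Hom C A B"
  shows "f \<boxplus> zero_arr C A B = f"
proof -
  obtain P r1 r2 d where P: "orthonormal_product C B B P r1 r2" and d: "d \<in> Hom C B P"
    "r1 \<cdot> d = ident C B" "r2 \<cdot> d = ident C B"
    by (rule diagonal_obtain[OF HomD(5)[OF f]])
  note D = orthonormal_productD[OF P] HomD[OF d(1)] HomD[OF f]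
  note s = cat_simps zero_simps
  have "r1 \<cdot> (r1\<^sup>\<star> \<cdot> f) = f" "r2 \<cdot> (r1\<^sup>\<star> \<cdot> f) = zero_arr C A B"
    by (simp_all add: cmp_reassoc[OF D(10)] cmp_reassoc[OF D(13)] D s)
  moreover have "r1\<^sup>\<star> \<cdot> f \<in> Hom C A P" by (simp add: Hom_def D s)
  moreover have "d\<^sup>\<star> \<cdot> r1\<^sup>\<star> = ident C B" using star_cmp_arrs[of d r1] by (simp add: D d s)
  then have "d\<^sup>\<star> \<cdot> (r1\<^sup>\<star> \<cdot> f) = f" using cmp_reassoc[of "d\<^sup>\<star>" "r1\<^sup>\<star>" "ident C B" f] by (simp add: D s)
  ultimately show ?thesis using arr_add_eq[OF P _ d, of "r1\<^sup>\<star> \<cdot> f" A] by simp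
qed

lemma add_comm:
  assumes f: "f \<in> Hom C A B" and g: "g \<in> Hom C A B"
  shows "f \<boxplus> g = g \<boxplus> f"
proof (rule add_obtain[OF f g])
  fix P r1 r2 d p
  assume P: "orthonormal_product C B B P r1 r2" and d: "d \<in> Hom C B P" "r1 \<cdot> d = ident C B"
    "r2 \<cdot> d = ident C B" and p: "p \<in> Hom C A P" "r1 \<cdot> p = f" "r2 \<cdot> p = g" "f \<boxplus> g = d\<^sup>\<star> \<cdot> p"
  have "r1 \<in> Hom C P B" "r2 \<in> Hom C P B"
    using orthonormal_productD[OF P] by (simp_all add: Hom_def)
  moreover have "\<exists>!h. h \<in> Hom C Y P \<and> r2 \<cdot> h = b \<and> r1 \<cdot> h = a"
    if "b \<in> Hom C Y B" "a \<in> Hom C Y B" for Y a b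
    using product_universal[OF P that(2,1)] by (simp add: conj_commute)
  ultimately have "orthonormal_product C B B P r2 r1"
    using orthonormal_productD[OF P]
    by (simp add: orthonormal_product_def binary_product_def coisometry_def)
  from arr_add_eq[OF this p(1) d(1,3,2)] show ?thesis using p by simp
qed

text \<open>Pairings add componentwise, and composing them with the codiagonal gives the interchange law;
  associativity is then the Eckmann--Hilton argument.\<close>

lemma add_interchange:
  assumes a: "a \<in> Hom C A B" and b: "b \<in> Hom C A B" and c: "c \<in> Hom C A B" and e: "e \<in> Hom C A B"
  shows "(a \<boxplus> b) \<boxplus> (c \<boxplus> e) = (a \<boxplus> c) \<boxplus> (b \<boxplus> e)"
proof -
  obtain P r1 r2 d where P: "orthonormal_product C B B P r1 r2" and d: "d \<in> Hom C B P"
    "r1 \<cdot> d = ident C B" "r2 \<cdot> d = ident C B"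
    by (rule diagonal_obtain[OF HomD(5)[OF a]])
  have r: "r1 \<in> Hom C P B" "r2 \<in> Hom C P B"
    using orthonormal_productD[OF P] by (simp_all add: Hom_def)
  obtain p where p: "p \<in> Hom C A P" "r1 \<cdot> p = a" "r2 \<cdot> p = c" by (rule pairing[OF P a c])
  obtain q where q: "q \<in> Hom C A P" "r1 \<cdot> q = b" "r2 \<cdot> q = e" by (rule pairing[OF P b e])
  have 1: "r1 \<cdot> (p \<boxplus> q) = a \<boxplus> b" "r2 \<cdot> (p \<boxplus> q) = c \<boxplus> e"
    using cmp_add[OF p(1) q(1) r(1)] cmp_add[OF p(1) q(1) r(2)] p q by simp_all
  have "(a \<boxplus> b) \<boxplus> (c \<boxplus> e) = d\<^sup>\<star> \<cdot> (p \<boxplus> q)"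
    using arr_add_eq[OF P add_in_Hom[OF p(1) q(1)] d] 1 by simp
  also have "\<dots> = d\<^sup>\<star> \<cdot> p \<boxplus> d\<^sup>\<star> \<cdot> q" by (rule cmp_add[OF p(1) q(1) star_in_Hom[OF d(1)]])
  also have "\<dots> = (a \<boxplus> c) \<boxplus> (b \<boxplus> e)"
    using arr_add_eq[OF P p(1) d] arr_add_eq[OF P q(1) d] p q by simp
  finally show ?thesis .
qed

lemma zero_add: "f \<in> Hom C A B \<Longrightarrow> zero_arr C A B \<boxplus> f = f"
  using add_comm[of f A B "zero_arr C A B"] add_zero[of f A B] zero_in_Hom[of A B] HomD(4,5)[of f A B]
  by simp

lemma add_assoc:
  assumes a: "a \<in> Hom C A B" and b: "b \<in> Hom C A B" and c: "c \<in> Hom C A B"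
  shows "(a \<boxplus> b) \<boxplus> c = a \<boxplus> (b \<boxplus> c)"
proof -
  have 0: "zero_arr C A B \<in> Hom C A B" using zero_in_Hom HomD[OF a] by blast
  show ?thesis using add_interchange[OF a b 0 c] add_zero[OF a] zero_add[OF c] by simp
qed

lemma product_resolution:
  assumes P: "orthonormal_product C X1 X2 P r1 r2"
  shows "r1\<^sup>\<star> \<cdot> r1 \<boxplus> r2\<^sup>\<star> \<cdot> r2 = ident C P"
proof -
  note D = orthonormal_productD[OF P]
  note s = cat_simps zero_simps
  have r: "r1 \<in> Hom C P X1" "r2 \<in> Hom C P X2" "r1\<^sup>\<star> \<cdot> r1 \<in> Hom C P P" "r2\<^sup>\<star> \<cdot> r2 \<in> Hom C P P"
    by (simp_all add: D s Hom_def)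
  note e = cmp_reassoc[OF D(10)] cmp_reassoc[OF D(11)] cmp_reassoc[OF D(12)] cmp_reassoc[OF D(13)]
  show ?thesis
  proof (rule product_eqI[OF P add_in_Hom[OF r(3,4)] ident_in_Hom[OF D(1)]])
    show "r1 \<cdot> (r1\<^sup>\<star> \<cdot> r1 \<boxplus> r2\<^sup>\<star> \<cdot> r2) = r1 \<cdot> ident C P"
      unfolding cmp_add[OF r(3,4,1)] using add_zero[OF r(1)] by (simp add: e D s)
    show "r2 \<cdot> (r1\<^sup>\<star> \<cdot> r1 \<boxplus> r2\<^sup>\<star> \<cdot> r2) = r2 \<cdot> ident C P"
      unfolding cmp_add[OF r(3,4,2)] using zero_add[OF r(2)] by (simp add: e D s)
  qed
qed

text \<open>Inner product of two morphisms into an orthonormal product, in terms of components.\<close>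

lemma star_cmp_product:
  assumes P: "orthonormal_product C X1 X2 P r1 r2" and f: "f \<in> Hom C A P" and g: "g \<in> Hom C B P"
  shows "f\<^sup>\<star> \<cdot> g = (r1 \<cdot> f)\<^sup>\<star> \<cdot> (r1 \<cdot> g) \<boxplus> (r2 \<cdot> f)\<^sup>\<star> \<cdot> (r2 \<cdot> g)"
proof -
  note D = orthonormal_productD[OF P] HomD[OF f] HomD[OF g]
  note s = cat_simps zero_simps
  have r: "r1\<^sup>\<star> \<cdot> r1 \<in> Hom C P P" "r2\<^sup>\<star> \<cdot> r2 \<in> Hom C P P"
    by (simp_all add: D s Hom_def)
  have "f\<^sup>\<star> \<cdot> g = (f\<^sup>\<star> \<cdot> (r1\<^sup>\<star> \<cdot> r1 \<boxplus> r2\<^sup>\<star> \<cdot> r2)) \<cdot> g"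
    unfolding product_resolution[OF P] by (simp add: D s)
  also have "\<dots> = (f\<^sup>\<star> \<cdot> (r1\<^sup>\<star> \<cdot> r1)) \<cdot> g \<boxplus> (f\<^sup>\<star> \<cdot> (r2\<^sup>\<star> \<cdot> r2)) \<cdot> g"
    unfolding cmp_add[OF r star_in_Hom[OF f]]
    by (rule add_cmp[OF cmp_in_Hom[OF r(1) star_in_Hom[OF f]] cmp_in_Hom[OF r(2) star_in_Hom[OF f]] g])
  finally show ?thesis by (simp add: D s)
qed

text \<open>Anisotropy applied to the pairing of \<open>f\<close> and \<open>g\<close>.\<close>

lemma add_star_cmp_eq_zero:
  assumes f: "f \<in> Hom C A X1" and g: "g \<in> Hom C A X2" and 0: "f\<^sup>\<star> \<cdot> f \<boxplus> g\<^sup>\<star> \<cdot> g = zero_arr C A A"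
  shows "f = zero_arr C A X1"
proof -
  obtain P r1 r2 where P: "orthonormal_product C X1 X2 P r1 r2"
    using ex_orthonormal_product[OF HomD(5)[OF f] HomD(5)[OF g]] by blast
  note D = orthonormal_productD[OF P] HomD[OF f] HomD[OF g]
  obtain p where p: "p \<in> Hom C A P" "r1 \<cdot> p = f" "r2 \<cdot> p = g" by (rule pairing[OF P f g])
  have "p = zero_arr C A P"
    by (rule anisotropic[OF p(1)]) (simp add: star_cmp_product[OF P p(1) p(1)] p 0)
  then show ?thesis using p(2) by (simp add: D zero_simps)
qed

section \<open>Additive inverses\<close>

text \<open>Let \<open>k\<close> be an isometric kernel of the codiagonal of \<open>X \<oplus> X\<close>, with adjoint components
  \<open>m, n : X \<rightarrow> K\<close>. Then \<open>m + n = 0\<close>, and since the diagonal is the kernel of \<open>k\<^sup>\<star>\<close>, the morphism \<open>m\<close>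
  is monic. As \<open>k\<close> is isometric, \<open>1 = m m\<^sup>\<star> + n n\<^sup>\<star>\<close>, and \<open>n n\<^sup>\<star> = m m\<^sup>\<star>\<close> because both are negatives
  of \<open>m n\<^sup>\<star>\<close>. Cancelling \<open>m\<close> on the left of \<open>m = (m m\<^sup>\<star> + m m\<^sup>\<star>) m = m (m\<^sup>\<star> m + m\<^sup>\<star> m)\<close> gives
  \<open>1 = m\<^sup>\<star> m + m\<^sup>\<star> m\<close>, whence \<open>m\<^sup>\<star> n + m\<^sup>\<star> n\<close> is a negative of \<open>1\<close>.\<close>

lemma ident_negative:
  assumes X: "X \<in> objs C"
  shows "\<exists>v\<in>Hom C X X. ident C X \<boxplus> v = zero_arr C X X"
proof -
  obtain P r1 r2 d where P: "orthonormal_product C X X P r1 r2" and d: "d \<in> Hom C X P"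
    "r1 \<cdot> d = ident C X" "r2 \<cdot> d = ident C X"
    by (rule diagonal_obtain[OF X])
  note s = cat_simps zero_simps
  note D = orthonormal_productD[OF P] HomD[OF d(1)]
  obtain f where f: "is_kernel C d f" using diagonal_is_kernel[OF P d] by blast
  have F: "f \<in> arrs C" "src C f = P" "f \<cdot> d = zero_arr C X (tgt C f)"
    using f by (auto simp: is_kernel_def D)
  obtain K k where k': "k \<in> Hom C K P" "k\<^sup>\<star> \<cdot> k = ident C K" "d\<^sup>\<star> \<cdot> k = zero_arr C K X"
    and ku: "\<And>Y g. \<lbrakk>g \<in> Hom C Y P; d\<^sup>\<star> \<cdot> g = zero_arr C Y X\<rbrakk> \<Longrightarrow> \<exists>h\<in>Hom C Y K. k \<cdot> h = g"
    by (rule isometric_kernel[OF star_in_Hom[OF d(1)]]) (rule that; blast)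
  note E = HomD[OF k'(1)]
  have du: "\<exists>!h. h \<in> Hom C Y X \<and> d \<cdot> h = g"
    if "g \<in> Hom C Y P" "f \<cdot> g = zero_arr C Y (tgt C f)" for g Y
    using f[unfolded is_kernel_def F(2) D(15)] that HomD(4)[OF that(1)] by simp
  have "d\<^sup>\<star> \<cdot> f\<^sup>\<star> = zero_arr C (tgt C f) X"
    using star_cmp_arrs[of d f] by (simp add: F D s)
  then obtain t where t: "t \<in> Hom C (tgt C f) K" "k \<cdot> t = f\<^sup>\<star>"
    using ku[of "f\<^sup>\<star>" "tgt C f"] by (auto simp: Hom_def F s)
  note T = HomD[OF t(1)]
  have f_eq: "f = t\<^sup>\<star> \<cdot> k\<^sup>\<star>" using star_cmp_arrs[of t k] t(2) by (simp add: F E T s)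
  \<comment> \<open>So \<open>k\<^sup>\<star> \<cdot> g = 0\<close> implies \<open>f \<cdot> g = 0\<close>, and \<open>g\<close> factors through the diagonal.\<close>
  have dk: "r1 \<cdot> g = r2 \<cdot> g" if g: "g \<in> Hom C Y P" "k\<^sup>\<star> \<cdot> g = zero_arr C Y K" for g Y
  proof -
    have "f \<cdot> g = zero_arr C Y (tgt C f)"
      unfolding f_eq using HomD[OF g(1)] g(2) by (simp add: E T s)
    then obtain h where h: "h \<in> Hom C Y X" "d \<cdot> h = g" using du[OF g(1)] by auto
    note H = HomD[OF h(1)]
    have "r1 \<cdot> (d \<cdot> h) = h" "r2 \<cdot> (d \<cdot> h) = h"
      by (simp_all add: cmp_reassoc[OF d(2)] cmp_reassoc[OF d(3)] D H s)
    then show ?thesis using h by simp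
  qed
  define m n where "m = (r1 \<cdot> k)\<^sup>\<star>" and "n = (r2 \<cdot> k)\<^sup>\<star>"
  have m: "m \<in> Hom C X K" and n: "n \<in> Hom C X K" by (simp_all add: m_def n_def Hom_def D E s)
  note M = HomD[OF m] HomD[OF n]
  have ms: "r1 \<cdot> k = m\<^sup>\<star>" "r2 \<cdot> k = n\<^sup>\<star>" by (simp_all add: m_def n_def D E star_star arr_cmp)
  have mn: "m \<boxplus> n = zero_arr C X K"
  proof -
    have "k\<^sup>\<star> \<cdot> d = m \<boxplus> n"
      using star_cmp_product[OF P k'(1) d(1)] by (simp add: ms d M s)
    moreover have "k\<^sup>\<star> \<cdot> d = zero_arr C X K" using star_cmp_arrs[of k "d\<^sup>\<star>"] k'(3) by (simp add: D E s)
    ultimately show ?thesis by simp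
  qed
  have kk: "m \<cdot> m\<^sup>\<star> \<boxplus> n \<cdot> n\<^sup>\<star> = ident C K"
    using star_cmp_product[OF P k'(1) k'(1)] by (simp add: ms k' M s)
  have mono: "a = b" if a: "a \<in> Hom C Y X" and b: "b \<in> Hom C Y X" and ab: "m \<cdot> a = m \<cdot> b" for a b Y
  proof -
    obtain g where g: "g \<in> Hom C Y P" "r1 \<cdot> g = a" "r2 \<cdot> g = b" by (rule pairing[OF P a b])
    have "k\<^sup>\<star> \<cdot> g = m \<cdot> b \<boxplus> n \<cdot> b"
      using star_cmp_product[OF P k'(1) g(1)] by (simp add: ms g M s ab)
    also have "\<dots> = (m \<boxplus> n) \<cdot> b" by (rule add_cmp[OF m n b, symmetric])
    also have "\<dots> = zero_arr C Y K" using HomD[OF b] by (simp add: mn M s)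
    finally show ?thesis using dk[OF g(1)] g by simp
  qed
  note S = star_in_Hom[OF m] star_in_Hom[OF n]
  have H: "m \<cdot> m\<^sup>\<star> \<in> Hom C K K" "m \<cdot> n\<^sup>\<star> \<in> Hom C K K" "n \<cdot> n\<^sup>\<star> \<in> Hom C K K"
    "m\<^sup>\<star> \<cdot> m \<in> Hom C X X" "m\<^sup>\<star> \<cdot> n \<in> Hom C X X"
    using cmp_in_Hom S m n by blast+
  have z: "m \<cdot> m\<^sup>\<star> \<boxplus> m \<cdot> n\<^sup>\<star> = zero_arr C K K" "m \<cdot> n\<^sup>\<star> \<boxplus> n \<cdot> n\<^sup>\<star> = zero_arr C K K"
    using cmp_add[OF S m, symmetric] add_cmp[OF m n S(2), symmetric] star_add[OF m n, symmetric]
    by (simp_all add: mn M zero_simps s)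
  have "n \<cdot> n\<^sup>\<star> = (m \<cdot> m\<^sup>\<star> \<boxplus> m \<cdot> n\<^sup>\<star>) \<boxplus> n \<cdot> n\<^sup>\<star>" by (simp add: z(1) zero_add[OF H(3)])
  also have "\<dots> = m \<cdot> m\<^sup>\<star>" by (simp add: add_assoc[OF H(1-3)] z(2) add_zero[OF H(1)])
  finally have kk': "m \<cdot> m\<^sup>\<star> \<boxplus> m \<cdot> m\<^sup>\<star> = ident C K" using kk by simp
  have "m = (m \<cdot> m\<^sup>\<star> \<boxplus> m \<cdot> m\<^sup>\<star>) \<cdot> m" by (simp add: kk' M s)
  also have "\<dots> = m \<cdot> (m\<^sup>\<star> \<cdot> m \<boxplus> m\<^sup>\<star> \<cdot> m)"
    unfolding add_cmp[OF H(1,1) m] cmp_add[OF H(4,4) m] by (simp add: M s)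
  finally have "m \<cdot> (m\<^sup>\<star> \<cdot> m \<boxplus> m\<^sup>\<star> \<cdot> m) = m \<cdot> ident C X" by (simp add: M s)
  then have one: "m\<^sup>\<star> \<cdot> m \<boxplus> m\<^sup>\<star> \<cdot> m = ident C X"
    by (rule mono[OF add_in_Hom[OF H(4,4)] ident_in_Hom[OF X]])
  have "m\<^sup>\<star> \<cdot> m \<boxplus> m\<^sup>\<star> \<cdot> n = zero_arr C X X"
    unfolding cmp_add[OF m n S(1), symmetric] mn by (simp add: M s)
  then have "ident C X \<boxplus> (m\<^sup>\<star> \<cdot> n \<boxplus> m\<^sup>\<star> \<cdot> n) = zero_arr C X X"
    unfolding one[symmetric] add_interchange[OF H(4,4,5,5)] by (simp add: add_zero zero_in_Hom X)
  then show ?thesis using add_in_Hom[OF H(5,5)] by blast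
qed

lemma End_simps:
  "carrier (End C A) = Hom C A A" "mult (End C A) = cmp C" "one (End C A) = ident C A"
  "zero (End C A) = zero_arr C A A" "add (End C A) = arr_add C"
  by (simp_all add: End_def)

lemma ring_End:
  assumes A: "A \<in> objs C"
  shows "ring (End C A)"
proof (rule ringI)
  show "abelian_group (End C A)"
  proof (rule abelian_groupI)
    fix x assume "x \<in> carrier (End C A)"
    then have x: "x \<in> Hom C A A" by (simp add: End_simps)
    obtain v where v: "v \<in> Hom C A A" "ident C A \<boxplus> v = zero_arr C A A"
      using ident_negative[OF A] by blast
    have "v \<cdot> x \<boxplus> x = (ident C A \<boxplus> v) \<cdot> x"
      unfolding add_cmp[OF ident_in_Hom[OF A] v(1) x]
      by (simp add: ident_cmp[OF x] add_comm[OF cmp_in_Hom[OF x v(1)] x])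
    then have "v \<cdot> x \<boxplus> x = zero_arr C A A" using HomD[OF x] by (simp add: v(2) zero_simps)
    then show "\<exists>y\<in>carrier (End C A). y \<oplus>\<^bsub>End C A\<^esub> x = \<zero>\<^bsub>End C A\<^esub>"
      using cmp_in_Hom[OF x v(1)] by (auto simp: End_simps)
  qed (auto simp: End_simps add_in_Hom zero_in_Hom A add_assoc zero_add intro: add_comm)
  show "monoid (End C A)"
    by (rule monoidI) (auto simp: End_simps ident_in_Hom A cmp_ident ident_cmp
        intro: cmp_in_Hom cmp_assoc)
qed (auto simp: End_simps intro: add_cmp cmp_add)

end

section \<open>The order and orthogonal projections\<close>

context pre_hilbert_star_category
begin

lemma herm_leD:
  assumes "herm_le C A a b"
  obtains X h where "h \<in> Hom C A X" "a \<boxplus> h\<^sup>\<star> \<cdot> h = b"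
proof -
  from assms obtain X h where ab: "a \<in> Hom C A A" "b \<in> Hom C A A"
    and h: "h \<in> Hom C A X" "b \<ominus>\<^bsub>End C A\<^esub> a = h\<^sup>\<star> \<cdot> h"
    by (auto simp: herm_le_def hermitian_def)
  interpret R: ring "End C A" using ring_End HomD[OF ab(1)] by blast
  have abc: "a \<in> carrier (End C A)" "b \<in> carrier (End C A)" using ab by (simp_all add: End_simps)
  have "a \<oplus>\<^bsub>End C A\<^esub> (b \<ominus>\<^bsub>End C A\<^esub> a) = b"
    using abc by (simp add: a_minus_def R.a_lcomm[of a b] R.r_neg)
  then show thesis using that[OF h(1)] h(2) by (simp add: End_simps)
qed

lemma herm_leI:
  assumes a: "hermitian C A a" and b: "hermitian C A b" and h: "h \<in> Hom C A X"
    and sum: "a \<boxplus> h\<^sup>\<star> \<cdot> h = b"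
  shows "herm_le C A a b"
proof -
  have ab: "a \<in> Hom C A A" "b \<in> Hom C A A" using a b by (auto simp: hermitian_def)
  interpret R: ring "End C A" using ring_End HomD[OF ab(1)] by blast
  have abc: "a \<in> carrier (End C A)" "b \<in> carrier (End C A)" using ab by (simp_all add: End_simps)
  have hh: "h\<^sup>\<star> \<cdot> h \<in> carrier (End C A)"
    using cmp_in_Hom[OF h star_in_Hom[OF h]] by (simp add: End_simps)
  have "b = h\<^sup>\<star> \<cdot> h \<oplus>\<^bsub>End C A\<^esub> a"
    using sum R.a_comm[of a "h\<^sup>\<star> \<cdot> h"] abc hh by (simp add: End_simps)
  then have "b \<ominus>\<^bsub>End C A\<^esub> a = h\<^sup>\<star> \<cdot> h"
    using abc hh by (simp add: a_minus_def R.a_assoc R.r_neg)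
  then show ?thesis using a b h by (auto simp: herm_le_def)
qed

lemma hermitian_ident: "A \<in> objs C \<Longrightarrow> hermitian C A (ident C A)"
  by (simp add: hermitian_def ident_in_Hom star_ident)

lemma hermitian_star_cmp:
  assumes f: "f \<in> Hom C A B"
  shows "hermitian C A (f\<^sup>\<star> \<cdot> f)"
  using HomD[OF f] cmp_in_Hom[OF f star_in_Hom[OF f]] by (simp add: hermitian_def cat_simps)

text \<open>Conjugate \<open>g\<^sup>\<star> g + h\<^sup>\<star> h = 1\<close> by \<open>i\<close>.\<close>

lemma contraction_cmp_isometry:
  assumes g: "g \<in> Hom C X P" and le: "herm_le C X (g\<^sup>\<star> \<cdot> g) (ident C X)"
    and i: "i \<in> Hom C Y X" "i\<^sup>\<star> \<cdot> i = ident C Y"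
  shows "herm_le C Y ((g \<cdot> i)\<^sup>\<star> \<cdot> (g \<cdot> i)) (ident C Y)"
proof -
  obtain W h where h: "h \<in> Hom C X W" "g\<^sup>\<star> \<cdot> g \<boxplus> h\<^sup>\<star> \<cdot> h = ident C X"
    by (rule herm_leD[OF le])
  note D = HomD[OF g] HomD[OF i(1)] HomD[OF h(1)]
  note gg = cmp_in_Hom[OF g star_in_Hom[OF g]] and hh = cmp_in_Hom[OF h(1) star_in_Hom[OF h(1)]]
  have "(i\<^sup>\<star> \<cdot> (g\<^sup>\<star> \<cdot> g)) \<cdot> i \<boxplus> (i\<^sup>\<star> \<cdot> (h\<^sup>\<star> \<cdot> h)) \<cdot> i = (i\<^sup>\<star> \<cdot> (g\<^sup>\<star> \<cdot> g \<boxplus> h\<^sup>\<star> \<cdot> h)) \<cdot> i"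
    unfolding cmp_add[OF gg hh star_in_Hom[OF i(1)]]
    by (rule add_cmp[OF cmp_in_Hom[OF gg star_in_Hom[OF i(1)]]
          cmp_in_Hom[OF hh star_in_Hom[OF i(1)]] i(1), symmetric])
  also have "\<dots> = ident C Y" unfolding h(2) by (simp add: D i cat_simps)
  finally have "(g \<cdot> i)\<^sup>\<star> \<cdot> (g \<cdot> i) \<boxplus> (h \<cdot> i)\<^sup>\<star> \<cdot> (h \<cdot> i) = ident C Y"
    by (simp add: D cat_simps)
  then show ?thesis
    by (rule herm_leI[OF hermitian_star_cmp[OF cmp_in_Hom[OF i(1) g]]
          hermitian_ident[OF D(9)] cmp_in_Hom[OF i(1) h(1)]])
qed

text \<open>Writing \<open>r\<^sup>\<star> r + h\<^sup>\<star> h = 1\<close> and \<open>u\<^sup>\<star> u + a\<^sup>\<star> a = 1\<close>, conjugation of the first equation by \<open>u\<close>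
  gives \<open>1 + (h u)\<^sup>\<star> (h u) + a\<^sup>\<star> a = 1\<close>, so \<open>h u = 0\<close> and \<open>u = (r\<^sup>\<star> r + h\<^sup>\<star> h) u = r\<^sup>\<star>\<close>.\<close>

lemma contractive_section_eq_star:
  assumes r: "r \<in> Hom C P Y" "herm_le C P (r\<^sup>\<star> \<cdot> r) (ident C P)"
    and u: "u \<in> Hom C Y P" "herm_le C Y (u\<^sup>\<star> \<cdot> u) (ident C Y)"
    and ru: "r \<cdot> u = ident C Y"
  shows "u = r\<^sup>\<star>"
proof -
  obtain W h where h: "h \<in> Hom C P W" "r\<^sup>\<star> \<cdot> r \<boxplus> h\<^sup>\<star> \<cdot> h = ident C P"
    by (rule herm_leD[OF r(2)])
  obtain V a where a: "a \<in> Hom C Y V" "u\<^sup>\<star> \<cdot> u \<boxplus> a\<^sup>\<star> \<cdot> a = ident C Y"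
    by (rule herm_leD[OF u(2)])
  note D = HomD[OF r(1)] HomD[OF u(1)] HomD[OF h(1)] HomD[OF a(1)]
  note rr = cmp_in_Hom[OF r(1) star_in_Hom[OF r(1)]] and hh = cmp_in_Hom[OF h(1) star_in_Hom[OF h(1)]]
  interpret R: ring "End C Y" by (rule ring_End[OF HomD(4)[OF u(1)]])
  define b where "b = (h \<cdot> u)\<^sup>\<star> \<cdot> (h \<cdot> u)"
  define c where "c = a\<^sup>\<star> \<cdot> a"
  have hu: "h \<cdot> u \<in> Hom C Y W" by (rule cmp_in_Hom[OF u(1) h(1)])
  have b: "b \<in> Hom C Y Y" and c: "c \<in> Hom C Y Y" and i: "ident C Y \<in> Hom C Y Y"
    using cmp_in_Hom[OF hu star_in_Hom[OF hu]] cmp_in_Hom[OF a(1) star_in_Hom[OF a(1)]]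
      ident_in_Hom D by (simp_all add: b_def c_def)
  have eq: "r\<^sup>\<star> \<cdot> (r \<cdot> u) \<boxplus> h\<^sup>\<star> \<cdot> (h \<cdot> u) = u"
    using add_cmp[OF rr hh u(1)] by (simp add: h(2) D cat_simps)
  have "u\<^sup>\<star> \<cdot> u = u\<^sup>\<star> \<cdot> (r\<^sup>\<star> \<cdot> (r \<cdot> u)) \<boxplus> u\<^sup>\<star> \<cdot> (h\<^sup>\<star> \<cdot> (h \<cdot> u))"
    using cmp_add[of "r\<^sup>\<star> \<cdot> (r \<cdot> u)" Y P "h\<^sup>\<star> \<cdot> (h \<cdot> u)" "u\<^sup>\<star>" Y]
    by (simp add: eq Hom_def D cat_simps)
  also have "u\<^sup>\<star> \<cdot> (r\<^sup>\<star> \<cdot> (r \<cdot> u)) = (r \<cdot> u)\<^sup>\<star> \<cdot> (r \<cdot> u)"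
    by (simp only: star_cmp[OF u(1) r(1)]) (simp add: D cat_simps)
  also have "\<dots> = ident C Y" unfolding ru by (simp add: D cat_simps)
  also have "u\<^sup>\<star> \<cdot> (h\<^sup>\<star> \<cdot> (h \<cdot> u)) = b" by (simp add: b_def D cat_simps)
  finally have "ident C Y \<boxplus> (b \<boxplus> c) = ident C Y"
    using a(2) by (simp add: c_def[symmetric] add_assoc[OF i b c])
  then have "b \<boxplus> c = zero_arr C Y Y"
    using R.add.l_cancel_one[of "ident C Y" "b \<boxplus> c"] i add_in_Hom[OF b c]
    by (simp add: End_simps)
  then have "h \<cdot> u = zero_arr C Y W"
    unfolding b_def c_def by (rule add_star_cmp_eq_zero[OF hu a(1)])
  then have "r\<^sup>\<star> \<boxplus> zero_arr C Y P = u" using eq by (simp add: ru D cat_simps zero_simps)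
  then show ?thesis using add_zero[OF star_in_Hom[OF r(1)]] by simp
qed

text \<open>The image \<open>i\<close> is an isometric kernel of \<open>c\<^sup>\<star>\<close>, for \<open>c\<close> a kernel of \<open>f\<^sup>\<star>\<close>. A morphism orthogonal
  to \<open>f\<close> factors through \<open>c\<close>, so it is also orthogonal to \<open>i\<close>.\<close>

lemma image_factorisation:
  assumes f: "f \<in> Hom C A X"
  shows "\<exists>Y i e. i \<in> Hom C Y X \<and> i\<^sup>\<star> \<cdot> i = ident C Y \<and> e \<in> Hom C A Y \<and> i \<cdot> e = f \<and>
    (\<forall>B. \<forall>g\<in>Hom C B X. f\<^sup>\<star> \<cdot> g = zero_arr C B A \<longrightarrow> i\<^sup>\<star> \<cdot> g = zero_arr C B Y)"
proof (rule isometric_kernel[OF star_in_Hom[OF f]])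
  fix K c
  assume c: "c \<in> Hom C K X" "c\<^sup>\<star> \<cdot> c = ident C K" "f\<^sup>\<star> \<cdot> c = zero_arr C K A"
    and cu: "\<And>Y g. \<lbrakk>g \<in> Hom C Y X; f\<^sup>\<star> \<cdot> g = zero_arr C Y A\<rbrakk> \<Longrightarrow> \<exists>h\<in>Hom C Y K. c \<cdot> h = g"
  show ?thesis
  proof (rule isometric_kernel[OF star_in_Hom[OF c(1)]])
    fix Y i
    assume i: "i \<in> Hom C Y X" "i\<^sup>\<star> \<cdot> i = ident C Y" "c\<^sup>\<star> \<cdot> i = zero_arr C Y K"
      and iu: "\<And>B g. \<lbrakk>g \<in> Hom C B X; c\<^sup>\<star> \<cdot> g = zero_arr C B K\<rbrakk> \<Longrightarrow> \<exists>h\<in>Hom C B Y. i \<cdot> h = g"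
    note D = HomD[OF f] HomD[OF c(1)] HomD[OF i(1)]
    have "c\<^sup>\<star> \<cdot> f = zero_arr C A K" using star_cmp_arrs[of c "f\<^sup>\<star>"] by (simp add: c D cat_simps zero_simps)
    then obtain e where e: "e \<in> Hom C A Y" "i \<cdot> e = f" using iu[OF f] by blast
    have ic: "i\<^sup>\<star> \<cdot> c = zero_arr C K Y" using star_cmp_arrs[of i "c\<^sup>\<star>"] by (simp add: i D cat_simps zero_simps)
    have "i\<^sup>\<star> \<cdot> g = zero_arr C B Y" if g: "g \<in> Hom C B X" "f\<^sup>\<star> \<cdot> g = zero_arr C B A" for B g
    proof -
      obtain h where h: "h \<in> Hom C B K" "c \<cdot> h = g" using cu[OF g] by blast
      have "i\<^sup>\<star> \<cdot> (c \<cdot> h) = zero_arr C B Y"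
        using HomD[OF h(1)] by (simp add: cmp_reassoc[OF ic] D cat_simps zero_simps)
      then show ?thesis using h by simp
    qed
    then show ?thesis using i(1,2) e by blast
  qed
qed

end

lemma (in ring) finsum_orthogonal_idempotents:
  assumes F: "finite F" and e: "e \<in> F \<rightarrow> carrier R"
    and idem: "\<And>j. j \<in> F \<Longrightarrow> e j \<otimes> e j = e j"
    and orth: "\<And>j k. \<lbrakk>j \<in> F; k \<in> F; j \<noteq> k\<rbrakk> \<Longrightarrow> e j \<otimes> e k = \<zero>"
  shows "finsum R e F \<otimes> finsum R e F = finsum R e F"
proof -
  have "finsum R e F \<otimes> e k = e k" if k: "k \<in> F" for k
  proof -
    have "finsum R e F \<otimes> e k = (\<Oplus>j\<in>F. e j \<otimes> e k)" using finsum_ldistr[OF F _ e] e k by auto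
    also have "\<dots> = (\<Oplus>j\<in>F. if k = j then e j else \<zero>)"
      using e k idem orth by (intro finsum_cong') auto
    also have "\<dots> = e k" by (rule add.finprod_singleton[OF k F e])
    finally show ?thesis .
  qed
  then have "(\<Oplus>k\<in>F. finsum R e F \<otimes> e k) = finsum R e F" using e by (intro finsum_cong') auto
  then show ?thesis using finsum_rdistr[OF F _ e, of "finsum R e F"] finsum_closed[OF e] by simp
qed

context pre_hilbert_star_category
begin

lemma hermitian_finsum:
  assumes "finite F" "A \<in> objs C" "\<And>j. j \<in> F \<Longrightarrow> hermitian C A (a j)"
  shows "hermitian C A (finsum (End C A) a F)"
proof -
  interpret R: ring "End C A" by (rule ring_End[OF assms(2)])
  show ?thesis
    using assms(1,3)
  proof (induction F)
    case empty
    then show ?case using assms(2) by (simp add: hermitian_def End_simps zero_in_Hom star_zero)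
  next
    case (insert k F)
    have "a \<in> F \<rightarrow> carrier (End C A)" "a k \<in> carrier (End C A)"
      using insert.prems by (auto simp: hermitian_def End_simps)
    then have "finsum (End C A) a (insert k F) = a k \<boxplus> finsum (End C A) a F"
      using R.finsum_insert insert.hyps by (simp add: End_simps)
    moreover have k: "hermitian C A (a k)" and F: "hermitian C A (finsum (End C A) a F)"
      using insert by blast+
    ultimately show ?case
      using star_add[of "a k" A A "finsum (End C A) a F"] by (simp add: hermitian_def add_in_Hom)
  qed
qed

text \<open>The complement \<open>q = 1 - p\<close> is again a Hermitian idempotent, so \<open>1 - p = q\<^sup>\<star> \<cdot> q\<close>.\<close>

lemma hermitian_idempotent_le_ident:
  assumes p: "hermitian C A p" "p \<cdot> p = p"
  shows "herm_le C A p (ident C A)"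
proof -
  have pH: "p \<in> Hom C A A" "p\<^sup>\<star> = p" using p by (auto simp: hermitian_def)
  have A: "A \<in> objs C" using HomD pH by blast
  interpret R: ring "End C A" by (rule ring_End[OF A])
  define q where "q = ident C A \<ominus>\<^bsub>End C A\<^esub> p"
  have pc: "p \<in> carrier (End C A)" "ident C A \<in> carrier (End C A)"
    using pH ident_in_Hom A by (simp_all add: End_simps)
  have qc: "q \<in> carrier (End C A)" using pc by (simp add: q_def)
  then have q: "q \<in> Hom C A A" by (simp add: End_simps)
  have "q \<oplus>\<^bsub>End C A\<^esub> p = ident C A"
    using pc by (simp add: q_def a_minus_def R.a_assoc R.l_neg)
  then have sum: "q \<boxplus> p = ident C A" by (simp add: End_simps)
  have "q\<^sup>\<star> \<boxplus> p = q \<boxplus> p"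
    using star_add[OF q pH(1)] sum star_ident[OF A] pH by simp
  then have qs: "q\<^sup>\<star> = q"
    using R.add.right_cancel[of p "q\<^sup>\<star>" q] pc qc star_in_Hom[OF q] by (simp add: End_simps)
  have "q \<cdot> p \<boxplus> p = zero_arr C A A \<boxplus> p"
    using add_cmp[OF q pH(1) pH(1)] by (simp add: sum p ident_cmp[OF pH(1)] zero_add[OF pH(1)])
  then have qp: "q \<cdot> p = zero_arr C A A"
    using R.add.right_cancel[of p "q \<cdot> p" "zero_arr C A A"] pc cmp_in_Hom[OF pH(1) q] R.zero_closed
    by (simp add: End_simps)
  have "q \<cdot> q = q"
    using cmp_add[OF q pH(1) q] add_zero[OF cmp_in_Hom[OF q q]] by (simp add: sum qp cmp_ident[OF q])
  then have "p \<boxplus> q\<^sup>\<star> \<cdot> q = ident C A" using sum add_comm[OF q pH(1)] by (simp add: qs)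
  then show ?thesis by (rule herm_leI[OF p(1) hermitian_ident[OF A] q])
qed

text \<open>Finite partial sums of the range projections of pairwise orthogonal isometries are Hermitian
  idempotents, so the adjoints of the isometries form an \<open>\<ell>\<^sup>2\<close>-span. The summands are written as
  \<open>f\<^sup>\<star> \<cdot> f\<close> for the legs \<open>f = (i j)\<^sup>\<star>\<close> of that span.\<close>

lemma orthogonal_isometries_bounded:
  assumes X: "X \<in> objs C" and i: "\<And>j. j \<in> J \<Longrightarrow> i j \<in> Hom C (Y j) X"
    and iso: "\<And>j. j \<in> J \<Longrightarrow> (i j)\<^sup>\<star> \<cdot> i j = ident C (Y j)"
    and orth: "\<And>j k. \<lbrakk>j \<in> J; k \<in> J; j \<noteq> k\<rbrakk> \<Longrightarrow> (i j)\<^sup>\<star> \<cdot> i k = zero_arr C (Y k) (Y j)"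
  shows "herm_upper_bound C X (partial_sums C X J (\<lambda>j. ((i j)\<^sup>\<star>)\<^sup>\<star> \<cdot> (i j)\<^sup>\<star>)) (ident C X)"
  unfolding herm_upper_bound_def partial_sums_def
proof (intro conjI ballI)
  show "hermitian C X (ident C X)" by (rule hermitian_ident[OF X])
next
  let ?e = "\<lambda>j. ((i j)\<^sup>\<star>)\<^sup>\<star> \<cdot> (i j)\<^sup>\<star>"
  fix a assume "a \<in> (\<lambda>F. finsum (End C X) ?e F) ` Fpow J"
  then obtain F where F: "finite F" "F \<subseteq> J" and a: "a = finsum (End C X) ?e F"
    by (auto simp: Fpow_def)
  interpret R: ring "End C X" by (rule ring_End[OF X])
  have herm: "hermitian C X (?e j)" if "j \<in> F" for j
    using hermitian_star_cmp[OF star_in_Hom[OF i]] F that by blast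
  have prod: "?e j \<cdot> ?e k = i j \<cdot> (((i j)\<^sup>\<star> \<cdot> i k) \<cdot> (i k)\<^sup>\<star>)" if "j \<in> F" "k \<in> F" for j k
    using HomD[OF i[of j]] HomD[OF i[of k]] that F by (simp add: cat_simps subset_iff)
  have "a \<otimes>\<^bsub>End C X\<^esub> a = a"
    unfolding a
  proof (rule R.finsum_orthogonal_idempotents[OF F(1)])
    show "?e \<in> F \<rightarrow> carrier (End C X)" using herm by (auto simp: hermitian_def End_simps)
    show "?e j \<otimes>\<^bsub>End C X\<^esub> ?e j = ?e j" if j: "j \<in> F" for j
      unfolding End_simps prod[OF j j]
      using HomD[OF i[of j]] iso[of j] j F by (simp add: cat_simps subset_iff)
    show "?e j \<otimes>\<^bsub>End C X\<^esub> ?e k = \<zero>\<^bsub>End C X\<^esub>" if j: "j \<in> F" and k: "k \<in> F" and jk: "j \<noteq> k" for j k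
      unfolding End_simps prod[OF j k]
      using HomD[OF i[of j]] HomD[OF i[of k]] orth[of j k] j k jk F
      by (simp add: cat_simps zero_simps subset_iff)
  qed
  then have "a \<cdot> a = a" by (simp add: End_simps)
  moreover have "hermitian C X a" unfolding a by (rule hermitian_finsum[OF F(1) X herm])
  ultimately show "herm_le C X a (ident C X)" by (rule hermitian_idempotent_le_ident[rotated])
qed

section \<open>Projections of an \<open>\<ell>\<^sup>2\<close>-product and order sums\<close>

lemma l2_product_projection_contraction:
  assumes P: "l2_product C J Y P r" and k: "k \<in> J"
  shows "herm_le C P ((r k)\<^sup>\<star> \<cdot> r k) (ident C P)"
proof -
  have span: "l2_span C J Y P r" using P by (simp add: l2_product_def)
  then have Po: "P \<in> objs C" and r: "\<And>j. j \<in> J \<Longrightarrow> r j \<in> Hom C P (Y j)" by (auto simp: l2_span_def)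
  interpret R: ring "End C P" by (rule ring_End[OF Po])
  \<comment> \<open>The span \<open>r\<close> factors through itself by the identity.\<close>
  have "herm_sup C P (partial_sums C P J (\<lambda>j. (r j)\<^sup>\<star> \<cdot> r j)) ((ident C P)\<^sup>\<star> \<cdot> ident C P)"
    using P span ident_in_Hom[OF Po] cmp_ident[OF r] unfolding l2_product_def by blast
  then have ub: "herm_upper_bound C P (partial_sums C P J (\<lambda>j. (r j)\<^sup>\<star> \<cdot> r j)) (ident C P)"
    by (simp add: herm_sup_def star_ident Po cat_simps)
  have "(r k)\<^sup>\<star> \<cdot> r k \<in> carrier (End C P)"
    using cmp_in_Hom[OF r[OF k] star_in_Hom[OF r[OF k]]] by (simp add: End_simps)
  then have "finsum (End C P) (\<lambda>j. (r j)\<^sup>\<star> \<cdot> r j) {k} = (r k)\<^sup>\<star> \<cdot> r k"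
    using R.finsum_insert[of "{}" k] by simp
  then have "(r k)\<^sup>\<star> \<cdot> r k \<in> partial_sums C P J (\<lambda>j. (r j)\<^sup>\<star> \<cdot> r j)"
    unfolding partial_sums_def using k by (intro image_eqI[of _ _ "{k}"]) (auto simp: Fpow_def)
  then show ?thesis using ub by (simp add: herm_upper_bound_def)
qed

lemma l2_product_mediator:
  assumes P: "l2_product C J Y P r" and g: "l2_span C J Y Z g"
  obtains h where "h \<in> Hom C Z P" "\<And>j. j \<in> J \<Longrightarrow> r j \<cdot> h = g j"
    "herm_sup C Z (partial_sums C Z J (\<lambda>j. (g j)\<^sup>\<star> \<cdot> g j)) (h\<^sup>\<star> \<cdot> h)"
proof -
  have u: "\<exists>!h. h \<in> Hom C Z P \<and> (\<forall>j\<in>J. r j \<cdot> h = g j)"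
    and s: "\<forall>h. h \<in> Hom C Z P \<and> (\<forall>j\<in>J. r j \<cdot> h = g j) \<longrightarrow>
      herm_sup C Z (partial_sums C Z J (\<lambda>j. (g j)\<^sup>\<star> \<cdot> g j)) (h\<^sup>\<star> \<cdot> h)"
    using P g by (auto simp: l2_product_def)
  from u obtain h where "h \<in> Hom C Z P \<and> (\<forall>j\<in>J. r j \<cdot> h = g j)" by auto
  then show thesis using that s by blast
qed

lemma l2_family_order_sum:
  assumes prods: "has_l2_products TYPE('i) C"
    and A: "A \<in> objs C" and X: "X \<in> objs C" and fam: "l2_family C A X (J :: 'i set) x"
  shows "\<exists>s. order_sum C A X J x s"
proof -
  have x: "\<And>j. j \<in> J \<Longrightarrow> x j \<in> Hom C A X"
    and xo: "\<And>j k. \<lbrakk>j \<in> J; k \<in> J; j \<noteq> k\<rbrakk> \<Longrightarrow> (x j)\<^sup>\<star> \<cdot> x k = zero_arr C A A"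
    and xb: "\<exists>u. herm_upper_bound C A (partial_sums C A J (\<lambda>j. (x j)\<^sup>\<star> \<cdot> x j)) u"
    using fam by (auto simp: l2_family_def orthogonal_family_def)
  have "\<forall>j\<in>J. \<exists>Y i e. i \<in> Hom C Y X \<and> i\<^sup>\<star> \<cdot> i = ident C Y \<and> e \<in> Hom C A Y \<and> i \<cdot> e = x j \<and>
    (\<forall>B. \<forall>g\<in>Hom C B X. (x j)\<^sup>\<star> \<cdot> g = zero_arr C B A \<longrightarrow> i\<^sup>\<star> \<cdot> g = zero_arr C B Y)"
    using image_factorisation[OF x] by blast
  then obtain Y i e where fact: "\<forall>j\<in>J. i j \<in> Hom C (Y j) X \<and> (i j)\<^sup>\<star> \<cdot> i j = ident C (Y j) \<and>
    e j \<in> Hom C A (Y j) \<and> i j \<cdot> e j = x j \<and>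
    (\<forall>B. \<forall>g\<in>Hom C B X. (x j)\<^sup>\<star> \<cdot> g = zero_arr C B A \<longrightarrow> (i j)\<^sup>\<star> \<cdot> g = zero_arr C B (Y j))"
    unfolding bchoice_iff by metis
  then have i: "\<And>j. j \<in> J \<Longrightarrow> i j \<in> Hom C (Y j) X"
    and iso: "\<And>j. j \<in> J \<Longrightarrow> (i j)\<^sup>\<star> \<cdot> i j = ident C (Y j)"
    and e: "\<And>j. j \<in> J \<Longrightarrow> e j \<in> Hom C A (Y j)"
    and ie: "\<And>j. j \<in> J \<Longrightarrow> i j \<cdot> e j = x j"
    and ann: "\<And>j B g. \<lbrakk>j \<in> J; g \<in> Hom C B X; (x j)\<^sup>\<star> \<cdot> g = zero_arr C B A\<rbrakk>
      \<Longrightarrow> (i j)\<^sup>\<star> \<cdot> g = zero_arr C B (Y j)"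
    by simp_all
  have io: "(i j)\<^sup>\<star> \<cdot> i k = zero_arr C (Y k) (Y j)" if j: "j \<in> J" and k: "k \<in> J" and jk: "j \<noteq> k" for j k
  proof (rule ann[OF j i[OF k]])
    note D = HomD[OF i[OF k]] HomD[OF x[OF j]]
    \<comment> \<open>Orthogonality passes to the image in one argument, then in the other.\<close>
    have "(i k)\<^sup>\<star> \<cdot> x j = zero_arr C A (Y k)"
      by (rule ann[OF k x[OF j]]) (rule xo[OF k j jk[symmetric]])
    then show "(x j)\<^sup>\<star> \<cdot> i k = zero_arr C (Y k) A"
      using star_cmp_arrs[of "x j" "(i k)\<^sup>\<star>"] by (simp add: D cat_simps zero_simps)
  qed
  have Yo: "\<forall>j\<in>J. Y j \<in> objs C" using HomD(4)[OF i] by blast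
  obtain P r where P: "l2_product C J Y P r" using prods Yo unfolding has_l2_products_def by blast
  have Pspan: "l2_span C J Y P r" using P by (simp add: l2_product_def)
  then have Po: "P \<in> objs C" and r: "\<And>j. j \<in> J \<Longrightarrow> r j \<in> Hom C P (Y j)" by (auto simp: l2_span_def)
  have ib: "herm_upper_bound C X (partial_sums C X J (\<lambda>j. ((i j)\<^sup>\<star>)\<^sup>\<star> \<cdot> (i j)\<^sup>\<star>)) (ident C X)"
    by (rule orthogonal_isometries_bounded[OF X i iso io])
  have ispan: "l2_span C J Y X (\<lambda>j. (i j)\<^sup>\<star>)"
    using X ib star_in_Hom[OF i] by (auto simp: l2_span_def)
  obtain g where g: "g \<in> Hom C X P" and rg: "\<And>j. j \<in> J \<Longrightarrow> r j \<cdot> g = (i j)\<^sup>\<star>"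
    and gs: "herm_sup C X (partial_sums C X J (\<lambda>j. ((i j)\<^sup>\<star>)\<^sup>\<star> \<cdot> (i j)\<^sup>\<star>)) (g\<^sup>\<star> \<cdot> g)"
    by (rule l2_product_mediator[OF P ispan]) (rule that; blast)
  have gle: "herm_le C X (g\<^sup>\<star> \<cdot> g) (ident C X)" using gs ib by (simp add: herm_sup_def)
  have gi: "g \<cdot> i k = (r k)\<^sup>\<star>" if k: "k \<in> J" for k
  proof (rule contractive_section_eq_star[OF r[OF k] l2_product_projection_contraction[OF P k]])
    note D = HomD[OF i[OF k]] HomD[OF g] HomD[OF r[OF k]]
    show "g \<cdot> i k \<in> Hom C (Y k) P" by (rule cmp_in_Hom[OF i[OF k] g])
    show "herm_le C (Y k) ((g \<cdot> i k)\<^sup>\<star> \<cdot> (g \<cdot> i k)) (ident C (Y k))"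
      by (rule contraction_cmp_isometry[OF g gle i[OF k] iso[OF k]])
    show "r k \<cdot> (g \<cdot> i k) = ident C (Y k)"
      by (simp add: cmp_reassoc[OF rg[OF k]] D iso[OF k])
  qed
  \<comment> \<open>So \<open>g\<close> is a coisometry, because the projections \<open>r j\<close> are jointly monic.\<close>
  note G = HomD[OF g]
  have gg: "g \<cdot> g\<^sup>\<star> = ident C P"
  proof -
    have "r j \<cdot> (g \<cdot> g\<^sup>\<star>) = r j" if j: "j \<in> J" for j
    proof -
      note D = HomD[OF i[OF j]] HomD[OF r[OF j]]
      have "r j \<cdot> (g \<cdot> g\<^sup>\<star>) = (i j)\<^sup>\<star> \<cdot> g\<^sup>\<star>" by (simp add: cmp_reassoc[OF rg[OF j]] D G cat_simps)
      also have "\<dots> = (g \<cdot> i j)\<^sup>\<star>" by (simp add: D G cat_simps)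
      also have "\<dots> = r j" by (simp add: gi[OF j] D cat_simps)
      finally show ?thesis .
    qed
    moreover have "\<exists>!h. h \<in> Hom C P P \<and> (\<forall>j\<in>J. r j \<cdot> h = r j)"
      using P Pspan by (simp add: l2_product_def)
    ultimately show ?thesis
      using cmp_in_Hom[OF star_in_Hom[OF g] g] ident_in_Hom[OF Po] cmp_ident[OF r] by blast
  qed
  have ee: "(e j)\<^sup>\<star> \<cdot> e j = (x j)\<^sup>\<star> \<cdot> x j" if j: "j \<in> J" for j
  proof -
    note D = HomD[OF i[OF j]] HomD[OF e[OF j]]
    have "(x j)\<^sup>\<star> \<cdot> x j = (e j)\<^sup>\<star> \<cdot> ((i j)\<^sup>\<star> \<cdot> (i j \<cdot> e j))"
      unfolding ie[OF j, symmetric] by (simp add: D cat_simps)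
    then show ?thesis by (simp add: cmp_reassoc[OF iso[OF j]] D cat_simps)
  qed
  have sums: "partial_sums C A J (\<lambda>j. (e j)\<^sup>\<star> \<cdot> e j) = partial_sums C A J (\<lambda>j. (x j)\<^sup>\<star> \<cdot> x j)"
  proof -
    interpret R: ring "End C A" by (rule ring_End[OF A])
    have "finsum (End C A) (\<lambda>j. (e j)\<^sup>\<star> \<cdot> e j) F = finsum (End C A) (\<lambda>j. (x j)\<^sup>\<star> \<cdot> x j) F"
      if "F \<in> Fpow J" for F
    proof (rule R.finsum_cong')
      show "(\<lambda>j. (x j)\<^sup>\<star> \<cdot> x j) \<in> F \<rightarrow> carrier (End C A)"
        using that x cmp_in_Hom star_in_Hom by (fastforce simp: End_simps Fpow_def)
    qed (use that ee in \<open>auto simp: Fpow_def\<close>)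
    then show ?thesis unfolding partial_sums_def by (rule image_cong[OF refl])
  qed
  have espan: "l2_span C J Y A e" using A e xb by (auto simp: l2_span_def sums)
  obtain h where h: "h \<in> Hom C A P" and rh: "\<And>j. j \<in> J \<Longrightarrow> r j \<cdot> h = e j"
    and hs: "herm_sup C A (partial_sums C A J (\<lambda>j. (e j)\<^sup>\<star> \<cdot> e j)) (h\<^sup>\<star> \<cdot> h)"
    by (rule l2_product_mediator[OF P espan]) (rule that; blast)
  note H = HomD[OF h]
  have "order_sum C A X J x (g\<^sup>\<star> \<cdot> h)"
    unfolding order_sum_def
  proof (intro conjI ballI)
    show "g\<^sup>\<star> \<cdot> h \<in> Hom C A X" by (rule cmp_in_Hom[OF h star_in_Hom[OF g]])
    have "(g\<^sup>\<star> \<cdot> h)\<^sup>\<star> \<cdot> (g\<^sup>\<star> \<cdot> h) = h\<^sup>\<star> \<cdot> h"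
      by (simp add: cmp_reassoc[OF gg] G H cat_simps)
    then show "herm_sup C A (partial_sums C A J (\<lambda>j. (x j)\<^sup>\<star> \<cdot> x j)) ((g\<^sup>\<star> \<cdot> h)\<^sup>\<star> \<cdot> (g\<^sup>\<star> \<cdot> h))"
      using hs by (simp add: sums)
  next
    fix j assume j: "j \<in> J"
    note D = HomD[OF i[OF j]] HomD[OF e[OF j]] HomD[OF r[OF j]]
    have "(g\<^sup>\<star> \<cdot> h)\<^sup>\<star> \<cdot> x j = h\<^sup>\<star> \<cdot> (g \<cdot> (i j \<cdot> e j))"
      unfolding ie[OF j, symmetric] by (simp add: D G H cat_simps)
    also have "\<dots> = (r j \<cdot> h)\<^sup>\<star> \<cdot> e j"
      by (simp add: cmp_reassoc[OF gi[OF j]] D G H cat_simps)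
    finally show "(g\<^sup>\<star> \<cdot> h)\<^sup>\<star> \<cdot> x j = (x j)\<^sup>\<star> \<cdot> x j" by (simp add: rh[OF j] ee[OF j])
  qed
  then show ?thesis by blast
qed

end

theorem proposition4p17:
  fixes C :: "('o, 'm) star_cat"
  assumes "pre_hilbert_star_category C"
    and "has_l2_products TYPE('i) C"
  shows "orthogonally_complete TYPE('i) C"
proof -
  interpret pre_hilbert_star_category C by (rule assms(1))
  show ?thesis
    unfolding orthogonally_complete_def using l2_family_order_sum[OF assms(2)] by blast
qed

end
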